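(* Let $W$ be a discrete memoryless channel with finite input alphabet $\mathcal X$ and finite output alphabet $\mathcal Y$, let $c:\mathcal X\to\mathbb R$ be a cost function and $K\in\mathbb R$ such that some distribution $P$ on $\mathcal X$ satisfies $\mathrm E_Pc\le K$, and assume $V_{W,c,K}^->0$. Then for every real $a$, \[ C_p^{\mathrm{DM}}(a\mid W,c,K)=\begin{cases} G\big(a/\sqrt{V_{W,c,K}^+}\big) & a\ge0,\\ G\big(a/\sqrt{V_{W,c,K}^-}\big) & a<0,\end{cases} \] and for every $0<\epsilon<1$, \[ C^{\mathrm{DM}}(\epsilon\mid W,c,K)=\begin{cases} \sqrt{V_{W,c,K}^+}\,G^{-1}(\epsilon) & \epsilon\ge1/2,\\ \sqrt{V_{W,c,K}^-}\,G^{-1}(\epsilon) & \epsilon<1/2.\end{cases} \]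
   Context: A channel $W$ is a family of probability distributions $W_x$ on $\mathcal Y$, $x\in\mathcal X$; $W^{\times n}(y|x)=\prod_iW(y_i|x_i)$. Logarithms are natural. A code for $W^{\times n}$ is $\Phi=(N,\phi,\{\mathcal D_i\}_{i=1}^N)$ with $\phi:\{1,\dots,N\}\to\mathcal X^n$ and disjoint $\mathcal D_i\subset\mathcal Y^n$; $|\Phi|=N$, $\mathrm{supp}(\Phi)=\{\phi(1),\dots,\phi(N)\}$, $P_{e,W^{\times n}}(\Phi)=\frac1N\sum_i(1-W^{\times n}_{\phi(i)}(\mathcal D_i))$. $W_P(y)=\sum_xP(x)W(y|x)$, $D(\cdot\|\cdot)$ is relative entropy, $I(P,W)=\sum_xP(x)D(W_x\|W_P)$, $V_{P,W}=\sum_xP(x)\sum_yW_x(y)\big(\log\frac{W_x(y)}{W_P(y)}-D(W_x\|W_P)\big)^2$. $\mathcal X^n_{c,K}=\{x\in\mathcal X^n:\sum_{i=1}^nc(x_i)\le nK\}$. $C_{W,c,K}=\max_{P:\mathrm E_Pc(x)\le K}I(P,W)$; $\mathcal V_{c,K}=\{P: I(P,W)=C_{W,c,K},\ \mathrm E_Pc(x)\le K\}$; $V^+_{W,c,K}=\max_{P\in\mathcal V_{c,K}}V_{P,W}$, $V^-_{W,c,K}=\min_{P\in\mathcal V_{c,K}}V_{P,W}$. $G$ is the standard normal distribution function. Over all code sequences $\{\Phi_n\}$ with $\mathrm{supp}(\Phi_n)\subset\mathcal X^n_{c,K}$ for all $n$: $C_p^{\mathrm{DM}}(a|W,c,K)=\inf\{\limsup_nP_{e,W^{\times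 n}}(\Phi_n):\liminf_n\frac1{\sqrt n}(\log|\Phi_n|-nC_{W,c,K})\ge a\}$, $C^{\mathrm{DM}}(\epsilon|W,c,K)=\sup\{\liminf_n\frac1{\sqrt n}(\log|\Phi_n|-nC_{W,c,K}):\limsup_nP_{e,W^{\times n}}(\Phi_n)\le\epsilon\}$. *)

theory Defs
  imports "HOL-Probability.Probability"
begin

definition is_channel :: "('x::finite \<Rightarrow> 'y::finite \<Rightarrow> real) \<Rightarrow> bool" where
  "is_channel W \<longleftrightarrow> (\<forall>x y. 0 \<le> W x y) \<and> (\<forall>x. (\<Sum>y\<in>UNIV. W x y) = 1)"

definition is_dist :: "('x::finite \<Rightarrow> real) \<Rightarrow> bool" where
  "is_dist P \<longleftrightarrow> (\<forall>x. 0 \<le> P x) \<and> (\<Sum>x\<in>UNIV. P x) = 1"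

definition outdist :: "('x::finite \<Rightarrow> real) \<Rightarrow> ('x \<Rightarrow> 'y \<Rightarrow> real) \<Rightarrow> 'y \<Rightarrow> real" where
  "outdist P W y = (\<Sum>x\<in>UNIV. P x * W x y)"

definition relent :: "('y::finite \<Rightarrow> real) \<Rightarrow> ('y \<Rightarrow> real) \<Rightarrow> real" where
  "relent p q = (\<Sum>y\<in>UNIV. if p y = 0 then 0 else p y * ln (p y / q y))"

definition mutinf :: "('x::finite \<Rightarrow> real) \<Rightarrow> ('x \<Rightarrow> 'y::finite \<Rightarrow> real) \<Rightarrow> real" where
  "mutinf P W = (\<Sum>x\<in>UNIV. P x * relent (W x) (outdist P W))"

definition dispersion :: "('x::finite \<Rightarrow> real) \<Rightarrow> ('x \<Rightarrow> 'y::finite \<Rightarrow> real) \<Rightarrow> real" where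
  "dispersion P W = (\<Sum>x\<in>UNIV. P x * (\<Sum>y\<in>UNIV.
      if W x y = 0 then 0
      else W x y * (ln (W x y / outdist P W y) - relent (W x) (outdist P W))\<^sup>2))"

definition expcost :: "('x::finite \<Rightarrow> real) \<Rightarrow> ('x \<Rightarrow> real) \<Rightarrow> real" where
  "expcost P c = (\<Sum>x\<in>UNIV. P x * c x)"

definition capacity :: "('x::finite \<Rightarrow> 'y::finite \<Rightarrow> real) \<Rightarrow> ('x \<Rightarrow> real) \<Rightarrow> real \<Rightarrow> real" where
  "capacity W c K = Sup {mutinf P W | P. is_dist P \<and> expcost P c \<le> K}"

definition cap_achievers :: "('x::finite \<Rightarrow> 'y::finite \<Rightarrow> real) \<Rightarrow> ('x \<Rightarrow> real) \<Rightarrow> real \<Rightarrow> ('x \<Rightarrow> real) set" where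
  "cap_achievers W c K = {P. is_dist P \<and> mutinf P W = capacity W c K \<and> expcost P c \<le> K}"

definition Vplus :: "('x::finite \<Rightarrow> 'y::finite \<Rightarrow> real) \<Rightarrow> ('x \<Rightarrow> real) \<Rightarrow> real \<Rightarrow> real" where
  "Vplus W c K = Sup ((\<lambda>P. dispersion P W) ` cap_achievers W c K)"

definition Vminus :: "('x::finite \<Rightarrow> 'y::finite \<Rightarrow> real) \<Rightarrow> ('x \<Rightarrow> real) \<Rightarrow> real \<Rightarrow> real" where
  "Vminus W c K = Inf ((\<lambda>P. dispersion P W) ` cap_achievers W c K)"

(* A code (N, phi, D) for block length n: N \<ge> 1 messages 1..N, codewords phi i
   (lists of length n), pairwise disjoint decoding sets D i of output words of length n. *)
type_synonym ('x,'y) code = "nat \<times> (nat \<Rightarrow> 'x list) \<times> (nat \<Rightarrow> 'y list set)"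

definition code_size :: "('x,'y) code \<Rightarrow> nat" where
  "code_size \<Phi> = fst \<Phi>"

definition is_code :: "nat \<Rightarrow> ('x,'y) code \<Rightarrow> bool" where
  "is_code n \<Phi> \<longleftrightarrow> (case \<Phi> of (N, \<phi>, D) \<Rightarrow>
      1 \<le> N \<and> (\<forall>i\<in>{1..N}. length (\<phi> i) = n \<and> D i \<subseteq> {ys. length ys = n})
      \<and> (\<forall>i\<in>{1..N}. \<forall>j\<in>{1..N}. i \<noteq> j \<longrightarrow> D i \<inter> D j = {}))"

definition prodchan :: "('x \<Rightarrow> 'y \<Rightarrow> real) \<Rightarrow> 'x list \<Rightarrow> 'y list \<Rightarrow> real" where
  "prodchan W xs ys = (\<Prod>i<length xs. W (xs ! i) (ys ! i))"

definition chan_prob :: "('x \<Rightarrow> 'y \<Rightarrow> real) \<Rightarrow> 'x list \<Rightarrow> 'y list set \<Rightarrow> real" where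
  "chan_prob W xs A = (\<Sum>ys\<in>A. prodchan W xs ys)"

definition err_prob :: "('x \<Rightarrow> 'y \<Rightarrow> real) \<Rightarrow> ('x,'y) code \<Rightarrow> real" where
  "err_prob W \<Phi> = (case \<Phi> of (N, \<phi>, D) \<Rightarrow>
      (1 / real N) * (\<Sum>i=1..N. 1 - chan_prob W (\<phi> i) (D i)))"

definition code_supp :: "('x,'y) code \<Rightarrow> 'x list set" where
  "code_supp \<Phi> = (case \<Phi> of (N, \<phi>, D) \<Rightarrow> \<phi> ` {1..N})"

definition cost_constrained :: "('x \<Rightarrow> real) \<Rightarrow> real \<Rightarrow> nat \<Rightarrow> 'x list set" where
  "cost_constrained c K n = {xs. length xs = n \<and> (\<Sum>i<n. c (xs ! i)) \<le> real n * K}"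

definition admissible_codes :: "('x \<Rightarrow> real) \<Rightarrow> real \<Rightarrow> (nat \<Rightarrow> ('x,'y) code) \<Rightarrow> bool" where
  "admissible_codes c K \<Phi>s \<longleftrightarrow>
     (\<forall>n. is_code n (\<Phi>s n) \<and> code_supp (\<Phi>s n) \<subseteq> cost_constrained c K n)"

definition second_order :: "('x::finite \<Rightarrow> 'y::finite \<Rightarrow> real) \<Rightarrow> ('x \<Rightarrow> real) \<Rightarrow> real
     \<Rightarrow> (nat \<Rightarrow> ('x,'y) code) \<Rightarrow> nat \<Rightarrow> real" where
  "second_order W c K \<Phi>s n = (ln (real (code_size (\<Phi>s n))) - real n * capacity W c K) / sqrt (real n)"

definition Cp_DM :: "('x::finite \<Rightarrow> 'y::finite \<Rightarrow> real) \<Rightarrow> ('x \<Rightarrow> real) \<Rightarrow> real \<Rightarrow> real \<Rightarrow> ereal" where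
  "Cp_DM W c K a = Inf {limsup (\<lambda>n. ereal (err_prob W (\<Phi>s n))) | \<Phi>s.
       admissible_codes c K \<Phi>s \<and> liminf (\<lambda>n. ereal (second_order W c K \<Phi>s n)) \<ge> ereal a}"

definition C_DM :: "('x::finite \<Rightarrow> 'y::finite \<Rightarrow> real) \<Rightarrow> ('x \<Rightarrow> real) \<Rightarrow> real \<Rightarrow> real \<Rightarrow> ereal" where
  "C_DM W c K \<epsilon> = Sup {liminf (\<lambda>n. ereal (second_order W c K \<Phi>s n)) | \<Phi>s.
       admissible_codes c K \<Phi>s \<and> limsup (\<lambda>n. ereal (err_prob W (\<Phi>s n))) \<le> ereal \<epsilon>}"

definition Gauss :: "real \<Rightarrow> real" where
  "Gauss x = measure (density lborel std_normal_density) {..x}"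

definition Gauss_inv :: "real \<Rightarrow> real" where
  "Gauss_inv p = (THE x. Gauss x = p)"

end

(* All capacity achievers P share one output distribution q, and the optimality condition
   sum_x Q(x) D(W_x || q) <= C holds for every Q obeying the cost constraint.  Along a sequence of
   codewords whose types tend to Q, the log-likelihood ratio of W_x against q^n is a sum of
   independent terms with mean at most nC and variance about n sum_x Q(x) Var_x; if Q is an achiever,
   this variance is n V_{Q,W}, so the Gaussian limit with some V in [V^-, V^+] appears, the worst
   one being selected by the sign of a.

   Converse: each codeword is tested against q^n and against the first n members of a countable
   dense family of output distributions.  If the limiting type Q is not an achiever, then
   I(Q,W) < C, and a member close to the output of Q makes the test fail with probability tending
   to 1 (the variance computed from q would be of no use for such Q).

   Achievability: greedy (Feinstein) codes inside the class of a type within O(1/n) of an achiever;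
   the uniform distribution on this class is at most a polynomial factor times P^n, which the
   scale sqrt(n) does not see. *)

theory Submission
  imports Defs "HOL-Real_Asymp.Real_Asymp" "HOL-Combinatorics.Multiset_Permutations"
begin

text \<open>The obstacle in the converse is uniformity over codewords. Compactness takes the place
  of a quantitative normal approximation: failure for infinitely many lengths yields words whose
  types converge along a subsequence. This convergence has no rate, so a mean is never replaced by
  its limit at scale sqrt(n); the optimality inequality is applied to each actual type instead. A Q
  that is not an achiever may satisfy that inequality with equality, because sum_x Q(x) D(W_x || q)
  = I(Q,W) + D(QW || q). Then q shows no gap in the mean, and the variance may lie outside
  [V^-, V^+]. A reference near QW restores a strict gap. Since the limit Q is fixed before the
  reference is chosen, one index of a countable family suffices, and the at most n + 2 candidates
  available at length n cost a factor that a gap of order sqrt(n) in the exponent absorbs. V^+ and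
  V^- are used only as limits of dispersions of achievers. The formula for C(epsilon) comes from the
  same two inequalities as C_p(a), because the limiting error is strictly increasing in a.\<close>

section \<open>Sums over words and the product channel\<close>

lemma finite_words [simp]: "finite {ys :: 'a::finite list. length ys = n}"
  using finite_lists_length_eq[of "UNIV :: 'a set" n] by simp

lemma sum_words_Suc:
  fixes f :: "'a::finite list \<Rightarrow> 'b::comm_monoid_add"
  shows "(\<Sum>ys | length ys = Suc n. f ys) = (\<Sum>y\<in>UNIV. \<Sum>ys | length ys = n. f (y # ys))"
proof -
  have "{ys :: 'a list. length ys = Suc n} = (\<lambda>(y, ys). y # ys) ` (UNIV \<times> {ys. length ys = n})"
    by (auto simp: length_Suc_conv image_iff)
  moreover have "inj_on (\<lambda>(y :: 'a, ys). y # ys) (UNIV \<times> {ys. length ys = n})"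
    by (auto simp: inj_on_def)
  ultimately show ?thesis
    by (simp add: sum.reindex sum.cartesian_product case_prod_unfold o_def)
qed

text \<open>Stated over a commutative semiring and for arbitrary letters of \<open>xs\<close>,
  because it is applied to real probabilities, to complex characteristic functions, to words over
  \<open>unit\<close> that only carry a length, and with the roles of inputs and outputs
  exchanged.\<close>

lemma sum_words_prod:
  fixes g :: "'x \<Rightarrow> 'y::finite \<Rightarrow> 'c::comm_semiring_1"
  shows "(\<Sum>ys | length ys = length xs. \<Prod>i<length xs. g (xs ! i) (ys ! i))
       = (\<Prod>i<length xs. \<Sum>y\<in>UNIV. g (xs ! i) y)"
proof (induction xs)
  case (Cons x xs)
  then show ?case
    by (simp add: sum_words_Suc prod.lessThan_Suc_shift sum_distrib_left[symmetric]
        sum_distrib_right[symmetric] del: prod.lessThan_Suc)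
qed simp

lemma sum_words_prod_const:
  fixes q :: "'y::finite \<Rightarrow> 'c::comm_semiring_1"
  shows "(\<Sum>ys | length ys = n. \<Prod>i<n. q (ys ! i)) = (\<Sum>y\<in>UNIV. q y) ^ n"
  using sum_words_prod[where xs = "replicate n ()" and g = "\<lambda>_. q"] by simp

lemma channel_nonneg: "is_channel W \<Longrightarrow> 0 \<le> W x y"
  and channel_sum: "is_channel W \<Longrightarrow> (\<Sum>y\<in>UNIV. W x y) = 1"
  by (auto simp: is_channel_def)

lemma prodchan_nonneg: "is_channel W \<Longrightarrow> 0 \<le> prodchan W xs ys"
  by (auto simp: prodchan_def is_channel_def intro!: prod_nonneg)

lemma prodchan_Cons: "prodchan W (x # xs) (y # ys) = W x y * prodchan W xs ys"
  by (simp add: prodchan_def prod.lessThan_Suc_shift del: prod.lessThan_Suc)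

lemma sum_prodchan:
  "is_channel W \<Longrightarrow> (\<Sum>ys | length ys = length xs. prodchan W xs ys) = 1"
  unfolding prodchan_def by (simp add: sum_words_prod channel_sum)

lemma chan_prob_mono:
  assumes "is_channel W" "A \<subseteq> B" "B \<subseteq> {ys. length ys = n}"
  shows "chan_prob W xs A \<le> chan_prob W xs B"
proof -
  have "finite B"
    by (rule finite_subset[OF assms(3) finite_words])
  then show ?thesis
    unfolding chan_prob_def using assms by (intro sum_mono2) (auto intro: prodchan_nonneg)
qed

lemma chan_prob_Collect:
  fixes W :: "'x \<Rightarrow> 'y::finite \<Rightarrow> real"
  shows "chan_prob W xs {ys. length ys = n \<and> R ys}
     = (\<Sum>ys | length ys = n. if R ys then prodchan W xs ys else 0)"
  unfolding chan_prob_def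
  by (subst sum.inter_filter[symmetric]) (auto intro!: sum.cong)

lemma chan_prob_le_1:
  assumes "is_channel W" "A \<subseteq> {ys. length ys = length xs}"
  shows "chan_prob W xs A \<le> 1"
  using chan_prob_mono[OF assms(1,2) order_refl, of xs] sum_prodchan[OF assms(1), of xs]
  by (simp add: chan_prob_def)

lemma chan_prob_compl:
  assumes "is_channel W"
  shows "chan_prob W xs {ys. length ys = length xs \<and> \<not> R ys}
       = 1 - chan_prob W xs {ys. length ys = length xs \<and> R ys}"
  unfolding chan_prob_Collect sum_prodchan[OF assms, of xs, symmetric] sum_subtractf[symmetric]
  by (intro sum.cong) auto

section \<open>Additive functionals of a codeword and likelihood ratios\<close>

definition additive :: "('x \<Rightarrow> 'y \<Rightarrow> real) \<Rightarrow> 'x list \<Rightarrow> 'y list \<Rightarrow> real" where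
  "additive z xs ys = (\<Sum>i<length xs. z (xs ! i) (ys ! i))"

lemma additive_Cons: "additive z (x # xs) (y # ys) = z x y + additive z xs ys"
  by (simp add: additive_def sum.lessThan_Suc_shift del: sum.lessThan_Suc)

text \<open>Variances of independent centred terms add: when the first letter is split off, the
  cross term of the square carries the factor \<open>(\<Sum>y\<in>UNIV. W x y * z x y)\<close>,
  which is zero.\<close>

lemma additive_variance:
  assumes W: "is_channel W" and z: "\<And>x. (\<Sum>y\<in>UNIV. W x y * z x y) = 0"
  shows "(\<Sum>ys | length ys = length xs. prodchan W xs ys * (additive z xs ys)\<^sup>2)
       = (\<Sum>i<length xs. \<Sum>y\<in>UNIV. W (xs ! i) y * (z (xs ! i) y)\<^sup>2)"
proof (induction xs)
  case (Cons x xs)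
  define m where "m = prodchan W xs"
  define h where "h = additive z xs"
  have "(\<Sum>ys | length ys = length (x # xs). prodchan W (x # xs) ys * (additive z (x # xs) ys)\<^sup>2)
      = (\<Sum>y\<in>UNIV. \<Sum>ys | length ys = length xs. W x y * (z x y)\<^sup>2 * m ys
          + (W x y * z x y) * (2 * (m ys * h ys)) + W x y * (m ys * (h ys)\<^sup>2))"
    by (simp add: sum_words_Suc prodchan_Cons additive_Cons power2_sum algebra_simps m_def h_def)
  also have "\<dots> = (\<Sum>y\<in>UNIV. W x y * (z x y)\<^sup>2) * (\<Sum>ys | length ys = length xs. m ys)
      + (\<Sum>y\<in>UNIV. W x y * z x y) * (\<Sum>ys | length ys = length xs. 2 * (m ys * h ys))
      + (\<Sum>y\<in>UNIV. W x y) * (\<Sum>ys | length ys = length xs. m ys * (h ys)\<^sup>2)"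
    by (simp only: sum.distrib sum_product)
  finally show ?case
    using Cons sum_prodchan[OF W, of xs] channel_sum[OF W] z
    by (simp add: m_def h_def sum.lessThan_Suc_shift del: sum.lessThan_Suc)
qed (simp add: additive_def)

text \<open>Serves the types that do not achieve capacity. The deviation is of order
  \<open>n\<close> there, so a second moment bound is enough even if the variance
  degenerates.\<close>

lemma additive_chebyshev:
  assumes W: "is_channel W" and z: "\<And>x. (\<Sum>y\<in>UNIV. W x y * z x y) = 0" and t: "0 < t"
  shows "chan_prob W xs {ys. length ys = length xs \<and> t < additive z xs ys}
       \<le> (\<Sum>i<length xs. \<Sum>y\<in>UNIV. W (xs ! i) y * (z (xs ! i) y)\<^sup>2) / t\<^sup>2"
proof -
  have "t\<^sup>2 * chan_prob W xs {ys. length ys = length xs \<and> t < additive z xs ys}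
      = (\<Sum>ys | length ys = length xs. if t < additive z xs ys then prodchan W xs ys * t\<^sup>2 else 0)"
    unfolding chan_prob_Collect sum_distrib_left by (intro sum.cong) auto
  also have "\<dots> \<le> (\<Sum>ys | length ys = length xs. prodchan W xs ys * (additive z xs ys)\<^sup>2)"
    using t by (intro sum_mono)
      (auto intro!: mult_left_mono power_mono mult_nonneg_nonneg prodchan_nonneg W)
  finally show ?thesis
    using t by (simp add: additive_variance[OF W z] field_simps)
qed

text \<open>The information density with a free reference \<open>q\<close>. Where
  \<open>W x y = 0\<close> it takes the default \<open>ln 0 = 0\<close>, and in expectations under
  \<open>W x\<close> it then meets the weight zero.\<close>

definition infodens :: "('x \<Rightarrow> 'y \<Rightarrow> real) \<Rightarrow> ('y \<Rightarrow> real) \<Rightarrow> 'x \<Rightarrow> 'y \<Rightarrow> real" where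
  "infodens W q x y = ln (W x y / q y)"

text \<open>The probabilities agree although the events need not: words of probability zero may lie
  in only one of them. Positivity of \<open>q\<close> is asked only at outputs reachable from
  letters of \<open>xs\<close>, since the capacity-achieving output distribution may vanish
  elsewhere.\<close>

lemma chan_prob_likelihood_ratio:
  assumes W: "is_channel W" and q: "\<And>x y. x \<in> set xs \<Longrightarrow> 0 < W x y \<Longrightarrow> 0 < q y"
  shows "chan_prob W xs {ys. length ys = length xs \<and>
             prodchan W xs ys \<le> exp \<gamma> * (\<Prod>i<length xs. q (ys ! i))}
       = chan_prob W xs {ys. length ys = length xs \<and> additive (infodens W q) xs ys \<le> \<gamma>}"
  unfolding chan_prob_Collect
proof (intro sum.cong refl)
  fix ys :: "'b list" assume "ys \<in> {ys. length ys = length xs}"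
  show "(if prodchan W xs ys \<le> exp \<gamma> * (\<Prod>i<length xs. q (ys ! i)) then prodchan W xs ys else 0)
      = (if additive (infodens W q) xs ys \<le> \<gamma> then prodchan W xs ys else 0)"
  proof (cases "prodchan W xs ys = 0")
    case False
    then have pos: "0 < W (xs ! i) (ys ! i)" if "i < length xs" for i
      using channel_nonneg[OF W, of "xs ! i" "ys ! i"] that
      by (auto simp: prodchan_def less_le)
    have qpos: "0 < q (ys ! i)" if "i < length xs" for i
      using pos[OF that] q[OF nth_mem[OF that]] by blast
    have "prodchan W xs ys = exp (additive (infodens W q) xs ys) * (\<Prod>i<length xs. q (ys ! i))"
      unfolding prodchan_def additive_def infodens_def exp_sum[OF finite_lessThan] prod.distrib[symmetric]
      using pos qpos by (intro prod.cong) (auto simp: less_imp_neq[symmetric])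
    moreover have "0 < (\<Prod>i<length xs. q (ys ! i))"
      using qpos by (intro prod_pos) auto
    ultimately show ?thesis by simp
  qed simp
qed

subsection \<open>The Gaussian distribution function\<close>

lemma Gauss_eq_cdf: "Gauss x = cdf std_normal_distribution x"
  by (simp add: Gauss_def cdf_def)

lemma isCont_Gauss: "isCont Gauss x"
proof -
  interpret real_distribution std_normal_distribution by (rule real_dist_normal_dist)
  have "emeasure std_normal_distribution {x} = 0"
    by (subst emeasure_density) (auto intro!: nn_integral_null_set simp: null_sets_def)
  then have "measure std_normal_distribution {x} = 0"
    by (simp add: measure_def)
  then show ?thesis
    using isCont_cdf[of x] by (simp add: Gauss_eq_cdf[abs_def])
qed

lemma Gauss_strict_mono: "strict_mono Gauss"
proof (rule strict_monoI)
  fix x y :: real assume "x < y"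
  interpret real_distribution std_normal_distribution by (rule real_dist_normal_dist)
  have "Gauss y - Gauss x = measure std_normal_distribution {x<..y}"
    using cdf_diff_eq[OF \<open>x < y\<close>] by (simp add: Gauss_eq_cdf)
  moreover have "measure std_normal_distribution {x<..y} \<noteq> 0"
  proof
    assume "measure std_normal_distribution {x<..y} = 0"
    then have "{x<..y} \<in> null_sets std_normal_distribution"
      by (auto simp: null_sets_def emeasure_eq_measure)
    then have "AE t in lborel. t \<in> {x<..y} \<longrightarrow> std_normal_density t = 0"
      by (subst (asm) null_sets_density_iff) auto
    then have "AE t in lborel. t \<notin> {x<..y}"
      by eventually_elim (auto simp: std_normal_density_def)
    then have "emeasure lborel {x<..y} = 0"
      by (subst (asm) AE_iff_measurable[of "{x<..y}"]) auto
    with \<open>x < y\<close> show False by simp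
  qed
  ultimately show "Gauss x < Gauss y"
    using measure_nonneg[of std_normal_distribution "{x<..y}"] by linarith
qed

lemma Gauss_at_top: "(Gauss \<longlongrightarrow> 1) at_top" and Gauss_at_bot: "(Gauss \<longlongrightarrow> 0) at_bot"
proof -
  interpret real_distribution std_normal_distribution by (rule real_dist_normal_dist)
  show "(Gauss \<longlongrightarrow> 1) at_top" "(Gauss \<longlongrightarrow> 0) at_bot"
    using cdf_lim_at_top_prob cdf_lim_at_bot by (simp_all add: Gauss_eq_cdf[abs_def])
qed

lemma Gauss_less_1: "Gauss x < 1"
proof -
  interpret real_distribution std_normal_distribution by (rule real_dist_normal_dist)
  show ?thesis
    using cdf_bounded_prob[of "x + 1"] strict_monoD[OF Gauss_strict_mono, of x "x + 1"]
    by (simp add: Gauss_eq_cdf)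
qed

text \<open>Symmetry of the normal law follows from its even characteristic function by Levy
  uniqueness. The two closed half-lines meet in \<open>0\<close>, which carries no mass. This value
  puts the change of case at \<epsilon> = 1/2.\<close>

lemma Gauss_0: "Gauss 0 = 1 / 2"
proof -
  interpret real_distribution std_normal_distribution by (rule real_dist_normal_dist)
  have dist_minus: "distr std_normal_distribution borel uminus = std_normal_distribution"
  proof (rule Levy_uniqueness)
    show "real_distribution (distr std_normal_distribution borel uminus)"
      by (rule real_distribution_distr) simp
    show "char (distr std_normal_distribution borel uminus) = char std_normal_distribution"
    proof
      fix t
      have "char (distr std_normal_distribution borel uminus) t = char std_normal_distribution (- t)"
        by (simp add: char_def integral_distr)
      then show "char (distr std_normal_distribution borel uminus) t = char std_normal_distribution t"
        by (simp add: char_std_normal_distribution)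
    qed
  qed (rule real_dist_normal_dist)
  have "Gauss 0 = measure (distr std_normal_distribution borel uminus) {..0}"
    by (simp add: dist_minus Gauss_def)
  also have "\<dots> = measure std_normal_distribution (uminus -` {..0} \<inter> space std_normal_distribution)"
    by (rule measure_distr) auto
  also have "uminus -` {..0} \<inter> space std_normal_distribution = {0::real..}"
    by auto
  finally have *: "Gauss 0 = measure std_normal_distribution {0..}" .
  have 0: "measure std_normal_distribution {0} = 0"
    using isCont_cdf[of 0] isCont_Gauss[of 0] by (simp add: Gauss_eq_cdf[abs_def])
  have "1 = measure std_normal_distribution ({..0} \<union> {0<..})"
  proof -
    have "{..0} \<union> {0<..} = (UNIV :: real set)" by auto
    then show ?thesis using prob_space by simp
  qed
  also have "\<dots> = Gauss 0 + measure std_normal_distribution {0<..}"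
    by (subst finite_measure_Union) (auto simp: Gauss_def)
  also have "measure std_normal_distribution {0<..} = measure std_normal_distribution {0..}"
  proof -
    have "measure std_normal_distribution ({0} \<union> {0<..}) = measure std_normal_distribution {0<..}"
      using 0 by (subst finite_measure_Union) auto
    moreover have "{0} \<union> {0<..} = {0::real..}" by auto
    ultimately show ?thesis by simp
  qed
  finally show ?thesis using * by simp
qed

lemma Gauss_inv:
  assumes "0 < p" "p < 1"
  shows "Gauss (Gauss_inv p) = p"
proof -
  obtain a where a: "Gauss a < p"
    using order_tendstoD(2)[OF Gauss_at_bot assms(1)] by (auto simp: eventually_at_bot_linorder)
  obtain b where b: "p < Gauss b"
    using order_tendstoD(1)[OF Gauss_at_top assms(2)] by (auto simp: eventually_at_top_linorder)
  have "a \<le> b"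
    using a b strict_mono_less[OF Gauss_strict_mono] by (smt (verit))
  then obtain x where "Gauss x = p"
    using IVT'[of Gauss a p b] a b isCont_Gauss continuous_at_imp_continuous_on by (metis less_imp_le)
  then show ?thesis
    unfolding Gauss_inv_def using strict_mono_eq[OF Gauss_strict_mono] by (metis (mono_tags, lifting) theI)
qed

lemma Gauss_inv_nonneg_iff:
  assumes "0 < p" "p < 1"
  shows "0 \<le> Gauss_inv p \<longleftrightarrow> 1 / 2 \<le> p"
  using strict_mono_less_eq[OF Gauss_strict_mono, of 0 "Gauss_inv p"] Gauss_inv[OF assms]
  by (simp add: Gauss_0)

subsection \<open>A central limit theorem along sequences of codewords\<close>

text \<open>The cubic error is the Taylor remainder, the linear term being killed by the zero mean;
  the quartic error comes from trading the quadratic Taylor polynomial for an exponential, so that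
  products over letters become exactly Gaussian. Both are uniform in the letter; smaller constants
  are dropped.\<close>

lemma char_expansion:
  fixes p z :: "'y::finite \<Rightarrow> real"
  assumes p: "\<And>y. 0 \<le> p y" "(\<Sum>y\<in>UNIV. p y) = 1" and z: "(\<Sum>y\<in>UNIV. p y * z y) = 0"
    and B: "\<And>y. \<bar>z y\<bar> \<le> B"
  shows "cmod ((\<Sum>y\<in>UNIV. of_real (p y) * iexp (s * z y))
           - of_real (exp (- (s\<^sup>2 * (\<Sum>y\<in>UNIV. p y * (z y)\<^sup>2) / 2))))
       \<le> B ^ 3 * \<bar>s\<bar> ^ 3 + B ^ 4 * s ^ 4"
proof -
  define v where "v = (\<Sum>y\<in>UNIV. p y * (z y)\<^sup>2)"
  have B0: "0 \<le> B" using B[of undefined] by linarith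
  have v0: "0 \<le> v" unfolding v_def using p by (intro sum_nonneg) auto
  have "v \<le> (\<Sum>y\<in>UNIV. p y * B\<^sup>2)"
    unfolding v_def using p B B0
    by (intro sum_mono mult_left_mono) (auto simp: abs_le_square_iff[symmetric])
  also have "\<dots> = B\<^sup>2" using p by (simp add: sum_distrib_right[symmetric])
  finally have vB: "v \<le> B\<^sup>2" .
  have "(\<Sum>y\<in>UNIV. of_real (p y) * iexp (s * z y)) - of_real (1 - s\<^sup>2 * v / 2)
      = (\<Sum>y\<in>UNIV. of_real (p y) * (iexp (s * z y) - (1 + \<i> * (s * z y) - (s * z y)\<^sup>2 / 2)))"
  proof -
    have "(\<Sum>y\<in>UNIV. of_real (p y) * (iexp (s * z y) - (1 + \<i> * (s * z y) - (s * z y)\<^sup>2 / 2)))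
        = (\<Sum>y\<in>UNIV. of_real (p y) * iexp (s * z y)) - of_real (\<Sum>y\<in>UNIV. p y)
          - \<i> * s * of_real (\<Sum>y\<in>UNIV. p y * z y) + of_real (s\<^sup>2 * (\<Sum>y\<in>UNIV. p y * (z y)\<^sup>2) / 2)"
      by (simp add: algebra_simps sum.distrib sum_subtractf sum_distrib_left power_mult_distrib
          sum_divide_distrib)
    then show ?thesis using p z by (simp add: v_def)
  qed
  also have "cmod \<dots> \<le> (\<Sum>y\<in>UNIV. p y * (B ^ 3 * \<bar>s\<bar> ^ 3))"
  proof (rule sum_norm_le)
    fix y
    have "cmod (iexp (s * z y) - (1 + \<i> * (s * z y) - (s * z y)\<^sup>2 / 2)) \<le> \<bar>s * z y\<bar> ^ 3 / 6"
      using iexp_approx1[of "s * z y" 2]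
      by (simp add: eval_nat_numeral algebra_simps)
    also have "\<dots> \<le> \<bar>s * z y\<bar> ^ 3" by simp
    also have "\<dots> \<le> B ^ 3 * \<bar>s\<bar> ^ 3"
      using power_mono[OF B[of y] abs_ge_zero, of 3]
      by (simp add: abs_mult power_mult_distrib mult.commute[of "\<bar>s\<bar> ^ 3"] mult_right_mono)
    finally show "cmod (of_real (p y) * (iexp (s * z y) - (1 + \<i> * (s * z y) - (s * z y)\<^sup>2 / 2)))
        \<le> p y * (B ^ 3 * \<bar>s\<bar> ^ 3)"
      using p(1)[of y] by (simp add: norm_mult mult_left_mono)
  qed
  also have "\<dots> = B ^ 3 * \<bar>s\<bar> ^ 3" using p by (simp add: sum_distrib_right[symmetric])
  finally have 1: "cmod ((\<Sum>y\<in>UNIV. of_real (p y) * iexp (s * z y)) - of_real (1 - s\<^sup>2 * v / 2))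
      \<le> B ^ 3 * \<bar>s\<bar> ^ 3" .
  define w where "w = s\<^sup>2 * v / 2"
  have w0: "0 \<le> w" unfolding w_def using v0 by simp
  have "\<bar>exp (- w) - (1 - w)\<bar> \<le> w\<^sup>2"
  proof -
    have "exp (- w) \<ge> 1 - w" using exp_ge_add_one_self[of "-w"] by simp
    moreover have "exp (- w) \<le> 1 - w + w\<^sup>2"
    proof -
      have "exp (-w) = 1 / exp w" by (simp add: exp_minus field_simps)
      also have "\<dots> \<le> 1 / (1 + w)"
        using exp_ge_add_one_self[of w] w0 by (intro divide_left_mono) auto
      \<comment> \<open>Because \<open>(1 + w) * (1 - w + w ^ 2) = 1 + w ^ 3\<close>.\<close>
      also have "\<dots> \<le> 1 - w + w\<^sup>2"
        using w0 by (simp add: field_simps power2_eq_square)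
      finally show ?thesis .
    qed
    ultimately show ?thesis by linarith
  qed
  also have "w\<^sup>2 \<le> (s\<^sup>2 * B\<^sup>2)\<^sup>2"
    unfolding w_def using vB v0 mult_left_mono[OF vB, of "s\<^sup>2"]
    by (intro power_mono) (auto intro!: mult_nonneg_nonneg order_trans[of "s\<^sup>2 * v" "s\<^sup>2 * B\<^sup>2"])
  also have "(s\<^sup>2 * B\<^sup>2)\<^sup>2 = B ^ 4 * s ^ 4" by (simp add: power_mult_distrib)
  finally have 2: "cmod (of_real (1 - s\<^sup>2 * v / 2) - of_real (exp (- (s\<^sup>2 * v / 2)))) \<le> B ^ 4 * s ^ 4"
    unfolding w_def[symmetric] of_real_diff[symmetric] norm_of_real by (simp add: abs_minus_commute)
  show ?thesis
    using norm_triangle_ineq[of "(\<Sum>y\<in>UNIV. of_real (p y) * iexp (s * z y)) - of_real (1 - s\<^sup>2 * v / 2)"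
        "of_real (1 - s\<^sup>2 * v / 2) - of_real (exp (- (s\<^sup>2 * v / 2)))"] 1 2
    unfolding v_def[symmetric] by simp
qed

text \<open>A central limit theorem for a triangular array: the whole word changes with
  \<open>k\<close>, and its letters give differently distributed terms. Finite alphabets make
  \<open>z\<close> uniformly bounded, so convergence of the averaged variance suffices for Levy
  continuity. Indexing by \<open>k\<close> rather than by length admits subsequences, and the moving
  threshold \<open>u k\<close> absorbs the drift of the mean in the achievability part.\<close>

lemma channel_clt:
  fixes W :: "'x::finite \<Rightarrow> 'y::finite \<Rightarrow> real" and z :: "'x \<Rightarrow> 'y \<Rightarrow> real" and xs :: "nat \<Rightarrow> 'x list"
  assumes W: "is_channel W" and z: "\<And>x. (\<Sum>y\<in>UNIV. W x y * z x y) = 0"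
    and len: "filterlim (\<lambda>k. length (xs k)) at_top sequentially"
    and var: "(\<lambda>k. (\<Sum>i<length (xs k). \<Sum>y\<in>UNIV. W (xs k ! i) y * (z (xs k ! i) y)\<^sup>2)
                 / real (length (xs k))) \<longlonglongrightarrow> V"
    and V: "0 < V" and u: "u \<longlonglongrightarrow> u0"
  shows "(\<lambda>k. chan_prob W (xs k) {ys. length ys = length (xs k) \<and>
              additive z (xs k) ys \<le> u k * sqrt (length (xs k))}) \<longlonglongrightarrow> Gauss (u0 / sqrt V)"
proof -
  define n where "n k = length (xs k)" for k
  define A where "A k = {ys :: 'y list. length ys = n k}" for k
  define N where "N k = point_measure (A k) (prodchan W (xs k))" for k
  \<comment> \<open>The shift by \<open>u0 - u k\<close> turns the moving threshold into the fixed
    continuity point \<open>u0 / sqrt V\<close>; in the characteristic function it costs only a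
    unimodular factor tending to 1.\<close>
  define X where "X k ys = (additive z (xs k) ys / sqrt (n k) - u k + u0) / sqrt V" for k ys
  define M where "M k = distr (N k) borel (X k)" for k
  define v where "v x = (\<Sum>y\<in>UNIV. W x y * (z x y)\<^sup>2)" for x
  have finA [simp]: "finite (A k)" for k by (simp add: A_def)
  have nat_lim: "filterlim n at_top sequentially"
    using len by (simp add: n_def[abs_def])
  have n_lim: "filterlim (\<lambda>k. real (n k)) at_top sequentially"
    by (rule filterlim_compose[OF filterlim_real_sequentially nat_lim])
  have npos: "\<forall>\<^sub>F k in sequentially. 0 < n k"
    using eventually_compose_filterlim[OF eventually_gt_at_top[of 0] nat_lim] .
  have probN: "prob_space (N k)" for k
    by (rule prob_spaceI)
      (simp add: N_def space_point_measure emeasure_point_measure_finite prodchan_nonneg[OF W]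
        sum_nonneg A_def n_def sum_prodchan[OF W] flip: ennreal_1 del: ennreal_1)
  have meas [measurable]: "X k \<in> borel_measurable (N k)" for k
    by (simp add: N_def)
  have rdM: "real_distribution (M k)" for k
    unfolding M_def by (rule prob_space.real_distribution_distr[OF probN meas])
  obtain B where B: "\<And>x y. \<bar>z x y\<bar> \<le> B"
  proof
    show "\<bar>z x y\<bar> \<le> (\<Sum>x\<in>UNIV. \<Sum>y\<in>UNIV. \<bar>z x y\<bar>)" for x y
      using member_le_sum[of y UNIV "\<lambda>y. \<bar>z x y\<bar>"]
        member_le_sum[of x UNIV "\<lambda>x. \<Sum>y\<in>UNIV. \<bar>z x y\<bar>"]
      by (simp add: sum_nonneg)
  qed
  have char_M: "char (M k) t = iexp (t * (u0 - u k) / sqrt V) *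
      (\<Prod>i<n k. \<Sum>y\<in>UNIV. of_real (W (xs k ! i) y) * iexp (t / sqrt V / sqrt (n k) * z (xs k ! i) y))"
    for k t
  proof -
    have "char (M k) t = (\<Sum>ys\<in>A k. prodchan W (xs k) ys *\<^sub>R iexp (t * X k ys))"
      unfolding char_def M_def
      by (subst integral_distr)
        (auto simp: N_def lebesgue_integral_point_measure_finite prodchan_nonneg[OF W])
    also have "\<dots> = (\<Sum>ys\<in>A k. iexp (t * (u0 - u k) / sqrt V) *
      (\<Prod>i<n k. of_real (W (xs k ! i) (ys ! i)) * iexp (t / sqrt V / sqrt (n k) * z (xs k ! i) (ys ! i))))"
    proof (intro sum.cong refl)
      fix ys
      have "t * X k ys = t * (u0 - u k) / sqrt V
          + (\<Sum>i<n k. t / sqrt V / sqrt (n k) * z (xs k ! i) (ys ! i))"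
        unfolding X_def additive_def n_def[symmetric] sum_distrib_left[symmetric]
        by (simp add: add_divide_distrib diff_divide_distrib algebra_simps)
      then have "iexp (t * X k ys) = iexp (t * (u0 - u k) / sqrt V) *
          (\<Prod>i<n k. iexp (t / sqrt V / sqrt (n k) * z (xs k ! i) (ys ! i)))"
        by (simp only: of_real_add of_real_sum distrib_left sum_distrib_left exp_add exp_sum[OF finite_lessThan])
      then show "prodchan W (xs k) ys *\<^sub>R iexp (t * X k ys) = iexp (t * (u0 - u k) / sqrt V) *
      (\<Prod>i<n k. of_real (W (xs k ! i) (ys ! i)) * iexp (t / sqrt V / sqrt (n k) * z (xs k ! i) (ys ! i)))"
        by (simp only: prodchan_def n_def prod.distrib scaleR_conv_of_real of_real_prod mult_ac)
    qed
    finally show ?thesis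
      using sum_words_prod[where xs = "xs k" and
          g = "\<lambda>x y. of_real (W x y) * iexp (t / sqrt V / sqrt (n k) * z x y)"]
      by (simp add: A_def n_def flip: sum_distrib_left)
  qed
  have char_lim: "(\<lambda>k. char (M k) t) \<longlonglongrightarrow> char std_normal_distribution t" for t
  proof -
    define s where "s k = t / sqrt V / sqrt (n k)" for k
    define F where "F k = (\<Prod>i<n k. \<Sum>y\<in>UNIV. of_real (W (xs k ! i) y) * iexp (s k * z (xs k ! i) y))" for k
    define H where "H k = (\<Prod>i<n k. complex_of_real (exp (- ((s k)\<^sup>2 * v (xs k ! i) / 2))))" for k
    have v0: "0 \<le> v x" for x
      unfolding v_def using channel_nonneg[OF W] by (intro sum_nonneg) auto
    \<comment> \<open>\<open>n k\<close> times the error per letter at argument \<open>s k\<close>,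
      which is of order \<open>1 / sqrt (n k)\<close>. Errors of factors simply add up because every
      factor has modulus at most 1.\<close>
    define e where "e k = B ^ 3 * (\<bar>t / sqrt V\<bar> ^ 3 / sqrt (n k)) + B ^ 4 * ((t / sqrt V) ^ 4 / n k)" for k
    have bound: "cmod (F k - H k) \<le> e k" if "0 < n k" for k
    proof -
      have "cmod (F k - H k) \<le> (\<Sum>i<n k. cmod ((\<Sum>y\<in>UNIV. of_real (W (xs k ! i) y) * iexp (s k * z (xs k ! i) y))
          - complex_of_real (exp (- ((s k)\<^sup>2 * v (xs k ! i) / 2)))))"
        unfolding F_def H_def
      proof (rule norm_prod_diff)
        fix i
        have "cmod (\<Sum>y\<in>UNIV. of_real (W (xs k ! i) y) * iexp (s k * z (xs k ! i) y))
            \<le> (\<Sum>y\<in>UNIV. W (xs k ! i) y)"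
          by (rule sum_norm_le) (simp add: norm_mult channel_nonneg[OF W])
        then show "cmod (\<Sum>y\<in>UNIV. of_real (W (xs k ! i) y) * iexp (s k * z (xs k ! i) y)) \<le> 1"
          by (simp add: channel_sum[OF W])
        show "cmod (complex_of_real (exp (- ((s k)\<^sup>2 * v (xs k ! i) / 2)))) \<le> 1"
          using v0 by (simp only: norm_of_real) simp
      qed
      also have "\<dots> \<le> (\<Sum>i<n k. B ^ 3 * \<bar>s k\<bar> ^ 3 + B ^ 4 * s k ^ 4)"
        unfolding v_def
        by (intro sum_mono char_expansion channel_nonneg[OF W] channel_sum[OF W] z B)
      also have "\<dots> = B ^ 3 * (n k * \<bar>s k\<bar> ^ 3) + B ^ 4 * (n k * s k ^ 4)"
        by (simp add: algebra_simps)
      also have "n k * \<bar>s k\<bar> ^ 3 = \<bar>t / sqrt V\<bar> ^ 3 / sqrt (n k)"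
      proof -
        have "sqrt (n k) ^ 3 = n k * sqrt (n k)"
          by (simp add: power3_eq_cube)
        then show ?thesis
          using that V by (simp add: s_def power_divide abs_divide abs_mult power_mult_distrib)
      qed
      also have "n k * s k ^ 4 = (t / sqrt V) ^ 4 / n k"
      proof -
        have "sqrt (n k) ^ 4 = n k * n k"
          by (simp add: power4_eq_xxxx)
        then show ?thesis
          using that by (simp add: s_def power_divide power_mult_distrib)
      qed
      finally show ?thesis by (simp add: e_def)
    qed
    have sqrt_lim: "filterlim (\<lambda>k. sqrt (real (n k))) at_top sequentially"
      by (rule filterlim_compose[OF sqrt_at_top n_lim])
    have "e \<longlonglongrightarrow> B ^ 3 * 0 + B ^ 4 * 0"
      unfolding e_def
      by (intro tendsto_intros tendsto_divide_0[OF tendsto_const]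
          filterlim_at_top_imp_at_infinity sqrt_lim n_lim)
    have "(\<lambda>k. F k - H k) \<longlonglongrightarrow> 0"
    proof (rule Lim_null_comparison[rotated])
      show "e \<longlonglongrightarrow> 0" using \<open>e \<longlonglongrightarrow> B ^ 3 * 0 + B ^ 4 * 0\<close> by simp
      show "\<forall>\<^sub>F k in sequentially. cmod (F k - H k) \<le> e k"
        using npos by eventually_elim (rule bound)
    qed
    moreover have "H \<longlonglongrightarrow> of_real (exp (- (t\<^sup>2) / 2))"
    proof -
      \<comment> \<open>The Gaussian product sees the word only through its averaged
        variance.\<close>
      have "H k = of_real (exp (- (t\<^sup>2 / V * ((\<Sum>i<n k. v (xs k ! i)) / n k) / 2)))" for k
      proof -
        have "H k = of_real (exp (\<Sum>i<n k. - ((s k)\<^sup>2 * v (xs k ! i) / 2)))"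
          by (simp add: H_def exp_sum)
        also have "(\<Sum>i<n k. - ((s k)\<^sup>2 * v (xs k ! i) / 2)) = - ((s k)\<^sup>2 * (\<Sum>i<n k. v (xs k ! i)) / 2)"
          by (simp add: sum_negf sum_distrib_left sum_divide_distrib)
        also have "(s k)\<^sup>2 * (\<Sum>i<n k. v (xs k ! i)) = t\<^sup>2 / V * ((\<Sum>i<n k. v (xs k ! i)) / n k)"
          using V by (simp add: s_def power_divide power_mult_distrib)
        finally show ?thesis .
      qed
      then have *: "H = (\<lambda>k. of_real (exp (- (t\<^sup>2 / V * ((\<Sum>i<n k. v (xs k ! i)) / n k) / 2))))"
        by auto
      have "H \<longlonglongrightarrow> of_real (exp (- (t\<^sup>2 / V * V / 2)))"
        unfolding * using var unfolding v_def n_def by (intro tendsto_intros) auto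
      then show ?thesis using V by simp
    qed
    ultimately have "(\<lambda>k. (F k - H k) + H k) \<longlonglongrightarrow> 0 + of_real (exp (- (t\<^sup>2) / 2))"
      by (rule tendsto_add)
    then have F_lim: "F \<longlonglongrightarrow> of_real (exp (- (t\<^sup>2) / 2))" by simp
    have "(\<lambda>k. iexp (t * (u0 - u k) / sqrt V)) \<longlonglongrightarrow> iexp (t * (u0 - u0) / sqrt V)"
      using V by (intro tendsto_intros u) auto
    then have "(\<lambda>k. iexp (t * (u0 - u k) / sqrt V) * F k) \<longlonglongrightarrow> 1 * of_real (exp (- (t\<^sup>2) / 2))"
      by (intro tendsto_mult F_lim) simp
    then show ?thesis
      unfolding char_M F_def s_def char_std_normal_distribution by simp
  qed
  have "weak_conv_m M std_normal_distribution"
    by (rule levy_continuity[OF rdM real_dist_normal_dist char_lim])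
  moreover have "isCont (cdf std_normal_distribution) (u0 / sqrt V)"
    using isCont_Gauss by (simp add: Gauss_eq_cdf[abs_def])
  ultimately have "(\<lambda>k. cdf (M k) (u0 / sqrt V)) \<longlonglongrightarrow> Gauss (u0 / sqrt V)"
    by (auto simp: weak_conv_m_def weak_conv_def Gauss_eq_cdf)
  moreover have "\<forall>\<^sub>F k in sequentially. cdf (M k) (u0 / sqrt V)
      = chan_prob W (xs k) {ys. length ys = length (xs k) \<and> additive z (xs k) ys \<le> u k * sqrt (length (xs k))}"
    using npos
  proof eventually_elim
    case (elim k)
    have "cdf (M k) (u0 / sqrt V) = measure (N k) (X k -` {..u0 / sqrt V} \<inter> space (N k))"
      unfolding cdf_def M_def by (rule measure_distr) (use meas in auto)
    also have "X k -` {..u0 / sqrt V} \<inter> space (N k)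
        = {ys. length ys = length (xs k) \<and> additive z (xs k) ys \<le> u k * sqrt (length (xs k))}"
      using V elim by (auto simp: N_def space_point_measure A_def X_def n_def divide_le_cancel field_simps)
    also have "measure (N k) \<dots> = chan_prob W (xs k) \<dots>"
      unfolding N_def chan_prob_def
      by (subst measure_point_measure_finite_if) (auto simp: prodchan_nonneg[OF W] A_def n_def)
    finally show ?case .
  qed
  ultimately show ?thesis
    by (rule Lim_transform_eventually)
qed

subsection \<open>Capacity-achieving input distributions\<close>

lemma dist_nonneg: "is_dist P \<Longrightarrow> 0 \<le> P x"
  and dist_sum: "is_dist P \<Longrightarrow> (\<Sum>x\<in>UNIV. P x) = 1"
  by (auto simp: is_dist_def)

lemma dist_le_1: "is_dist P \<Longrightarrow> P x \<le> 1"
  using dist_sum[of P] dist_nonneg[of P] member_le_sum[of x UNIV P] by auto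

lemma outdist_nonneg: "is_channel W \<Longrightarrow> is_dist P \<Longrightarrow> 0 \<le> outdist P W y"
  by (auto simp: outdist_def is_channel_def is_dist_def intro!: sum_nonneg mult_nonneg_nonneg)

lemma outdist_sum: "is_channel W \<Longrightarrow> is_dist P \<Longrightarrow> (\<Sum>y\<in>UNIV. outdist P W y) = 1"
  unfolding outdist_def
  by (subst sum.swap) (simp add: sum_distrib_left[symmetric] channel_sum dist_sum)

lemma outdist_pos:
  assumes "is_channel W" "is_dist P" "0 < P x" "0 < W x y"
  shows "0 < outdist P W y"
proof -
  have "P x * W x y \<le> outdist P W y"
    unfolding outdist_def
    using assms by (intro member_le_sum) (auto intro!: mult_nonneg_nonneg simp: dist_nonneg channel_nonneg)
  then show ?thesis using assms mult_pos_pos[of "P x" "W x y"] by linarith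
qed

definition negent :: "('x \<Rightarrow> 'y::finite \<Rightarrow> real) \<Rightarrow> 'x \<Rightarrow> real" where
  "negent W x = (\<Sum>y\<in>UNIV. W x y * ln (W x y))"

lemma relent_infodens: "relent (W x) q = (\<Sum>y\<in>UNIV. W x y * infodens W q x y)"
  unfolding relent_def infodens_def by (intro sum.cong) auto

text \<open>Separates a part linear in \<open>Q\<close> from a cross-entropy that depends on
  \<open>Q\<close> only through its output distribution. With \<open>q\<close> the output
  distribution of \<open>Q\<close> this is the entropy form of mutual information.\<close>

lemma sum_relent:
  assumes W: "is_channel W" and Q: "is_dist Q"
    and q: "\<And>x y. 0 < Q x \<Longrightarrow> 0 < W x y \<Longrightarrow> 0 < q y"
  shows "(\<Sum>x\<in>UNIV. Q x * relent (W x) q)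
       = (\<Sum>x\<in>UNIV. Q x * negent W x) - (\<Sum>y\<in>UNIV. outdist Q W y * ln (q y))"
proof -
  have "Q x * relent (W x) q = Q x * negent W x - (\<Sum>y\<in>UNIV. Q x * W x y * ln (q y))" for x
  proof (cases "Q x = 0")
    case False
    then have "0 < Q x" using dist_nonneg[OF Q, of x] by simp
    have "relent (W x) q = (\<Sum>y\<in>UNIV. W x y * ln (W x y) - W x y * ln (q y))"
      unfolding relent_def
    proof (intro sum.cong refl)
      fix y
      show "(if W x y = 0 then 0 else W x y * ln (W x y / q y)) = W x y * ln (W x y) - W x y * ln (q y)"
        using channel_nonneg[OF W, of x y] q[OF \<open>0 < Q x\<close>, of y]
        by (auto simp: ln_div less_le right_diff_distrib)
    qed
    then show ?thesis
      by (simp add: negent_def sum_subtractf right_diff_distrib sum_distrib_left mult.assoc)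
  qed simp
  then have "(\<Sum>x\<in>UNIV. Q x * relent (W x) q)
      = (\<Sum>x\<in>UNIV. Q x * negent W x) - (\<Sum>x\<in>UNIV. \<Sum>y\<in>UNIV. Q x * W x y * ln (q y))"
    by (simp add: sum_subtractf)
  also have "(\<Sum>x\<in>UNIV. \<Sum>y\<in>UNIV. Q x * W x y * ln (q y)) = (\<Sum>y\<in>UNIV. outdist Q W y * ln (q y))"
    by (subst sum.swap) (simp add: outdist_def sum_distrib_right)
  finally show ?thesis .
qed

lemma mutinf_eq:
  assumes "is_channel W" "is_dist P"
  shows "mutinf P W = (\<Sum>x\<in>UNIV. P x * negent W x)
           - (\<Sum>y\<in>UNIV. outdist P W y * ln (outdist P W y))"
  unfolding mutinf_def by (rule sum_relent[OF assms]) (rule outdist_pos[OF assms])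

lemma continuous_on_xlnx: "continuous_on {0..} (\<lambda>t::real. t * ln t)"
  unfolding continuous_on_def
proof
  fix t :: real assume "t \<in> {0..}"
  show "((\<lambda>t. t * ln t) \<longlongrightarrow> t * ln t) (at t within {0..})"
  proof (cases "t = 0")
    case True
    have "((\<lambda>t::real. t * ln t) \<longlongrightarrow> 0) (at_right 0)" by real_asymp
    then have "((\<lambda>t::real. t * ln t) \<longlongrightarrow> 0) (at 0 within {0..})"
      by (simp add: at_within_Ici_at_right)
    then show ?thesis using True by simp
  next
    case False
    then show ?thesis by (intro tendsto_intros) auto
  qed
qed

text \<open>Read off the entropy form, where the logarithm of each output probability is damped by
  that probability; the single divergences in the definition can blow up where an output probability
  tends to zero.\<close>

lemma continuous_on_mutinf:
  assumes "is_channel W"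
  shows "continuous_on {P. is_dist P} (\<lambda>P. mutinf P W)"
proof -
  have c: "continuous_on S (\<lambda>P :: 'a \<Rightarrow> real. P x)" for x S
    by (rule continuous_on_subset[OF continuous_on_product_coordinates]) simp
  have "continuous_on {P. is_dist P} (\<lambda>P. (\<Sum>x\<in>UNIV. P x * negent W x)
           - (\<Sum>y\<in>UNIV. outdist P W y * ln (outdist P W y)))"
  proof (intro continuous_on_diff continuous_on_sum)
    show "continuous_on {P. is_dist P} (\<lambda>P. P x * negent W x)" for x
      by (intro continuous_intros c)
    fix y
    have "continuous_on {P. is_dist P} (\<lambda>P. outdist P W y)"
      unfolding outdist_def by (intro continuous_intros c)
    then show "continuous_on {P. is_dist P} (\<lambda>P. outdist P W y * ln (outdist P W y))"
      by (rule continuous_on_compose2[OF continuous_on_xlnx]) (auto simp: outdist_nonneg[OF assms])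
  qed
  then show ?thesis
    by (rule continuous_on_eq) (simp add: mutinf_eq[OF assms])
qed

text \<open>Used twice: for the existence of achievers, and in the converse for the convergence of
  the types of bad codewords.\<close>

lemma compact_feasible: "compact {P :: 'x::finite \<Rightarrow> real. is_dist P \<and> expcost P c \<le> K}"
proof -
  have c: "continuous_on UNIV (\<lambda>P :: 'x \<Rightarrow> real. P x)" for x
    by simp
  have "compact (PiE UNIV (\<lambda>_ :: 'x. {0..1 :: real}))"
    using compactin_PiE[of "\<lambda>_. euclidean" "UNIV :: 'x set" "\<lambda>_. {0..1 :: real}"]
    by (simp add: euclidean_product_topology)
  moreover have "closed {P :: 'x \<Rightarrow> real. is_dist P \<and> expcost P c \<le> K}"
    unfolding is_dist_def expcost_def
    by (intro closed_Collect_conj closed_Collect_all closed_Collect_le closed_Collect_eq continuous_intros c)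
  moreover have "{P :: 'x \<Rightarrow> real. is_dist P \<and> expcost P c \<le> K} \<subseteq> PiE UNIV (\<lambda>_. {0..1})"
    using dist_nonneg dist_le_1 by (auto simp: PiE_UNIV_domain)
  ultimately show ?thesis
    by (metis closed_Int_compact inf.absorb1)
qed

lemma capacity_attained:
  assumes W: "is_channel W" and ex: "\<exists>P. is_dist P \<and> expcost P c \<le> K"
  shows "cap_achievers W c K \<noteq> {}"
    and "\<And>P. is_dist P \<Longrightarrow> expcost P c \<le> K \<Longrightarrow> mutinf P W \<le> capacity W c K"
proof -
  let ?F = "{P. is_dist P \<and> expcost P c \<le> K}"
  have "continuous_on ?F (\<lambda>P. mutinf P W)"
    by (rule continuous_on_subset[OF continuous_on_mutinf[OF W]]) auto
  then obtain P where P: "P \<in> ?F" "\<And>Q. Q \<in> ?F \<Longrightarrow> mutinf Q W \<le> mutinf P W"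
    using continuous_attains_sup[OF compact_feasible, of c K "\<lambda>P. mutinf P W"] ex by auto
  then have "capacity W c K = mutinf P W"
    unfolding capacity_def by (intro cSup_eq_maximum) auto
  with P show "cap_achievers W c K \<noteq> {}"
    and "\<And>P. is_dist P \<Longrightarrow> expcost P c \<le> K \<Longrightarrow> mutinf P W \<le> capacity W c K"
    by (auto simp: cap_achievers_def)
qed

text \<open>For \<open>q > 0\<close> this is \<open>ln v \<le> v - 1\<close> at
  \<open>v = u / q\<close>. For \<open>q = 0\<close> the terms with \<open>ln q\<close> and division
  by \<open>q\<close> have the default value 0 and \<open>- r\<close> cancels \<open>r - q\<close>,
  so both sides equal \<open>t * r * ln (t * r)\<close>; the infinite slope at zero appears as
  \<open>r * ln t\<close>.\<close>

lemma xlnx_secant_bound: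
  fixes q r t :: real
  assumes "0 \<le> q" "0 \<le> r" "0 < t" "t < 1"
  shows "((1 - t) * q + t * r) * ln ((1 - t) * q + t * r) - q * ln q
       \<le> t * ((r - q) * ln q + (r - q) + t * ((r - q)\<^sup>2 / q)
              + (if q = 0 then r * ln t + (r * ln r - r) else 0))"
proof (cases "q = 0")
  case True
  then show ?thesis using assms by (cases "r = 0") (auto simp: ln_mult algebra_simps)
next
  case False
  then have q: "0 < q" using assms by simp
  define u where "u = (1 - t) * q + t * r"
  have u: "0 < u" unfolding u_def using q assms by (intro add_pos_nonneg) auto
  have "u * ln (u / q) \<le> u * (u / q - 1)"
    using u q by (intro mult_left_mono ln_le_minus_one) auto
  then have "u * ln u - q * ln q \<le> (u - q) * ln q + u * (u / q - 1)"
    using u q by (simp add: ln_div algebra_simps)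
  also have "u * (u / q - 1) = (u - q) + (u - q)\<^sup>2 / q"
    using q by (simp add: field_simps power2_eq_square)
  also have "u - q = t * (r - q)" by (simp add: u_def algebra_simps)
  also have "t * (r - q) * ln q + (t * (r - q) + (t * (r - q))\<^sup>2 / q)
      = t * ((r - q) * ln q + (r - q) + t * ((r - q)\<^sup>2 / q))"
    by (simp add: power_mult_distrib power2_eq_square distrib_left mult.assoc mult.left_commute)
  finally show ?thesis
    unfolding u_def[symmetric] using False by simp
qed

text \<open>Moving from an achiever \<open>P\<close> towards \<open>Q\<close> by \<open>t\<close> changes the information by at least
  \<open>t (\<Sum>x. Q x D(W\<^sub>x, W\<^sub>P) - C) + S t ln (1/t) - O(t\<^sup>2)\<close>, where \<open>S\<close> is the mass that \<open>Q W\<close> puts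
  outside the support of \<open>P W\<close>; hence \<open>S = 0\<close> and the linear term is nonpositive.\<close>
lemma cap_achiever_optimality:
  assumes W: "is_channel W" and ex: "\<exists>P. is_dist P \<and> expcost P c \<le> K"
    and P: "P \<in> cap_achievers W c K" and Q: "is_dist Q" "expcost Q c \<le> K"
  shows "\<And>x y. 0 < Q x \<Longrightarrow> 0 < W x y \<Longrightarrow> 0 < outdist P W y"
    and "(\<Sum>x\<in>UNIV. Q x * relent (W x) (outdist P W)) \<le> capacity W c K"
proof -
  define q where "q = outdist P W"
  define r where "r = outdist Q W"
  define J where "J R = (\<Sum>x\<in>UNIV. R x * negent W x)" for R
  have Pd: "is_dist P" "expcost P c \<le> K" and PC: "mutinf P W = capacity W c K"
    using P by (auto simp: cap_achievers_def)
  have q0: "0 \<le> q y" and r0: "0 \<le> r y" for y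
    using outdist_nonneg W Pd Q by (auto simp: q_def r_def)
  define A where "A = (\<Sum>y\<in>UNIV. (r y - q y) * ln (q y))"
  define B where "B = (\<Sum>y\<in>UNIV. (r y - q y)\<^sup>2 / q y)"
  define S where "S = (\<Sum>y\<in>UNIV. if q y = 0 then r y else 0)"
  define S' where "S' = (\<Sum>y\<in>UNIV. if q y = 0 then r y * ln (r y) - r y else 0)"
  \<comment> \<open>Optimality of \<open>P\<close> against the mixture \<open>R\<close>, feasible
    because the constraint is affine, divided by \<open>t\<close>. The terms
    \<open>r y - q y\<close> drop out since both distributions have mass 1.\<close>
  have main: "J Q - J P \<le> A + t * B + S * ln t + S'" if t: "0 < t" "t < 1" for t
  proof -
    define R where "R x = (1 - t) * P x + t * Q x" for x
    have Rd: "is_dist R"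
      using Pd Q t by (auto simp: is_dist_def R_def sum.distrib sum_distrib_left[symmetric])
    have "expcost R c = (1 - t) * expcost P c + t * expcost Q c"
      by (simp add: expcost_def R_def sum.distrib sum_distrib_left algebra_simps sum_subtractf)
    also have "\<dots> \<le> (1 - t) * K + t * K"
      using Pd Q t by (intro add_mono mult_left_mono) auto
    finally have Rc: "expcost R c \<le> K" by (simp add: algebra_simps)
    have oR: "outdist R W y = (1 - t) * q y + t * r y" for y
      by (simp add: outdist_def R_def q_def r_def sum.distrib sum_distrib_left algebra_simps sum_subtractf)
    have "J R - J P = t * (J Q - J P)"
      by (simp add: J_def R_def sum.distrib sum_distrib_left algebra_simps sum_subtractf)
    moreover have "mutinf R W \<le> mutinf P W"
      using capacity_attained(2)[OF W ex Rd Rc] PC by simp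
    moreover have "mutinf R W = J R - (\<Sum>y\<in>UNIV. ((1 - t) * q y + t * r y) * ln ((1 - t) * q y + t * r y))"
      unfolding mutinf_eq[OF W Rd] J_def oR ..
    moreover have "mutinf P W = J P - (\<Sum>y\<in>UNIV. q y * ln (q y))"
      unfolding mutinf_eq[OF W Pd(1)] J_def q_def ..
    ultimately have "t * (J Q - J P) \<le> (\<Sum>y\<in>UNIV. ((1 - t) * q y + t * r y) * ln ((1 - t) * q y + t * r y) - q y * ln (q y))"
      unfolding sum_subtractf by linarith
    also have "\<dots> \<le> (\<Sum>y\<in>UNIV. t * ((r y - q y) * ln (q y) + (r y - q y) + t * ((r y - q y)\<^sup>2 / q y)
              + (if q y = 0 then r y * ln t + (r y * ln (r y) - r y) else 0)))"
      by (intro sum_mono xlnx_secant_bound q0 r0 t)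
    also have "\<dots> = t * (A + ((\<Sum>y\<in>UNIV. r y) - (\<Sum>y\<in>UNIV. q y)) + t * B + (S * ln t + S'))"
      unfolding A_def B_def S_def S'_def sum_distrib_left[symmetric] sum.distrib sum_distrib_right
        sum_subtractf[symmetric]
      by (simp add: sum.distrib[symmetric] sum_distrib_left[symmetric] if_distrib[of "\<lambda>u. u * ln t"] cong: if_cong)
        (auto intro!: sum.cong)
    also have "(\<Sum>y\<in>UNIV. r y) - (\<Sum>y\<in>UNIV. q y) = 0"
      using outdist_sum[OF W Q(1)] outdist_sum[OF W Pd(1)] by (simp add: q_def r_def)
    finally show ?thesis using t by simp
  qed
  \<comment> \<open>A positive \<open>S\<close> would send the right side of \<open>main\<close> to
    minus infinity as \<open>t\<close> tends to 0, while the left side is fixed.\<close>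
  have S0: "S = 0"
  proof (rule ccontr)
    assume "S \<noteq> 0"
    moreover have "0 \<le> S" unfolding S_def using r0 by (intro sum_nonneg) auto
    ultimately have "0 < S" by simp
    then have "filterlim (\<lambda>t. A + t * B + S * ln t + S') at_bot (at_right 0)"
      by real_asymp
    then have "\<forall>\<^sub>F t in at_right 0. A + t * B + S * ln t + S' < J Q - J P"
      by (simp add: filterlim_at_bot_dense)
    moreover have "\<forall>\<^sub>F t in at_right (0::real). 0 < t \<and> t < 1"
      by (auto simp: eventually_at_right_field intro!: exI[of _ 1])
    ultimately have "\<forall>\<^sub>F t in at_right (0::real). False"
      by eventually_elim (use main in force)
    then show False by simp
  qed
  have r_supp: "r y = 0" if "q y = 0" for y
  proof -
    have "(if q y = 0 then r y else 0) = 0"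
      using S0 unfolding S_def by (subst (asm) sum_nonneg_eq_0_iff) (use r0 in auto)
    then show ?thesis using that by simp
  qed
  show supp: "0 < outdist P W y" if "0 < Q x" "0 < W x y" for x y
  proof -
    have "0 < r y" unfolding r_def using outdist_pos W Q(1) that by blast
    then have "q y \<noteq> 0" using r_supp[of y] by auto
    then show ?thesis using q0[of y] by (auto simp: q_def)
  qed
  have "S' = 0" unfolding S'_def using r_supp by (intro sum.neutral) auto
  have "((\<lambda>t. A + t * B) \<longlongrightarrow> A + 0 * B) (at_right 0)"
    by (intro tendsto_intros)
  moreover have "\<forall>\<^sub>F t in at_right (0::real). J Q - J P \<le> A + t * B"
    using main S0 \<open>S' = 0\<close> by (auto simp: eventually_at_right_field intro!: exI[of _ 1])
  ultimately have "J Q - J P \<le> A + 0 * B"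
    by (rule tendsto_lowerbound) simp
  moreover have "A = (\<Sum>y\<in>UNIV. r y * ln (q y)) - (\<Sum>y\<in>UNIV. q y * ln (q y))"
    by (simp add: A_def algebra_simps sum_subtractf)
  ultimately show "(\<Sum>x\<in>UNIV. Q x * relent (W x) (outdist P W)) \<le> capacity W c K"
    using sum_relent[OF W Q(1) supp] mutinf_eq[OF W Pd(1)] PC
    by (simp add: J_def q_def r_def)
qed

text \<open>With \<open>r\<close> the output distribution of \<open>Q\<close>, the optimality
  condition for \<open>P\<close> at \<open>Q\<close> reads I(Q,W) + D(r || q) \<le> C, and I(Q,W) =
  C leaves D(r || q) \<le> 0.\<close>

lemma cap_achievers_same_outdist:
  assumes W: "is_channel W" and ex: "\<exists>P. is_dist P \<and> expcost P c \<le> K"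
    and P: "P \<in> cap_achievers W c K" and Q: "Q \<in> cap_achievers W c K"
  shows "outdist Q W = outdist P W"
proof
  fix y
  have Qd: "is_dist Q" "expcost Q c \<le> K" "mutinf Q W = capacity W c K" and Pd: "is_dist P"
    using P Q by (auto simp: cap_achievers_def)
  note opt = cap_achiever_optimality[OF W ex P Qd(1,2)]
  define q where "q = outdist P W"
  define r where "r = outdist Q W"
  have q0: "0 \<le> q y" and r0: "0 \<le> r y" for y
    using outdist_nonneg W Pd Qd by (auto simp: q_def r_def)
  have supp: "0 < q y" if "0 < r y" for y
  proof -
    have "\<exists>x. Q x * W x y \<noteq> 0"
    proof (rule ccontr)
      assume "\<nexists>x. Q x * W x y \<noteq> 0"
      then have "r y = 0" unfolding r_def outdist_def by (intro sum.neutral) simp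
      then show False using that by simp
    qed
    then obtain x where "Q x * W x y \<noteq> 0" ..
    then have "0 < Q x" "0 < W x y"
      using dist_nonneg[OF Qd(1), of x] channel_nonneg[OF W, of x y] by (auto simp: less_le)
    then show ?thesis using opt(1) by (simp add: q_def)
  qed
  \<comment> \<open>Subtracting \<open>r y - q y\<close>, which sums to zero, makes every summand of
    the divergence nonnegative, so a vanishing total forces equality letter by letter.\<close>
  have gibbs: "0 \<le> r y * ln (r y) - r y * ln (q y) - (r y - q y)"
    and gibbs_eq: "r y * ln (r y) - r y * ln (q y) - (r y - q y) = 0 \<Longrightarrow> r y = q y" for y
  proof -
    consider "r y = 0" | "0 < r y" "0 < q y" using supp r0 by (auto simp: less_le)
    then have "0 \<le> r y * ln (r y) - r y * ln (q y) - (r y - q y) \<and>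
        (r y * ln (r y) - r y * ln (q y) - (r y - q y) = 0 \<longrightarrow> r y = q y)"
    proof cases
      case 2
      have *: "r y * ln (r y) - r y * ln (q y) - (r y - q y) = r y * ((q y / r y - 1) - ln (q y / r y))"
        using 2 by (simp add: ln_div field_simps)
      show ?thesis
        unfolding * using 2 ln_le_minus_one[of "q y / r y"] ln_eq_minus_one[of "q y / r y"]
        by (auto intro!: mult_nonneg_nonneg)
    qed (use q0 in auto)
    then show "0 \<le> r y * ln (r y) - r y * ln (q y) - (r y - q y)"
      and "r y * ln (r y) - r y * ln (q y) - (r y - q y) = 0 \<Longrightarrow> r y = q y" by auto
  qed
  have "(\<Sum>y\<in>UNIV. r y * ln (r y)) - (\<Sum>y\<in>UNIV. r y * ln (q y)) \<le> 0"
    using opt(2) sum_relent[OF W Qd(1) opt(1)] mutinf_eq[OF W Qd(1)] Qd(3)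
    by (simp add: q_def r_def)
  moreover have "(\<Sum>y\<in>UNIV. r y) = 1" "(\<Sum>y\<in>UNIV. q y) = 1"
    using outdist_sum W Pd Qd by (auto simp: q_def r_def)
  ultimately have "(\<Sum>y\<in>UNIV. r y * ln (r y) - r y * ln (q y) - (r y - q y)) \<le> 0"
    by (simp add: sum_subtractf)
  moreover have "0 \<le> (\<Sum>y\<in>UNIV. r y * ln (r y) - r y * ln (q y) - (r y - q y))"
    by (intro sum_nonneg gibbs)
  ultimately have "r y * ln (r y) - r y * ln (q y) - (r y - q y) = 0"
    using sum_nonneg_eq_0_iff[of UNIV "\<lambda>y. r y * ln (r y) - r y * ln (q y) - (r y - q y)"] gibbs
    by auto
  then show "outdist Q W y = outdist P W y"
    using gibbs_eq[of y] by (simp add: q_def r_def)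
qed

section \<open>Dispersion on the set of achievers\<close>

definition infovar :: "('x \<Rightarrow> 'y::finite \<Rightarrow> real) \<Rightarrow> ('y \<Rightarrow> real) \<Rightarrow> 'x \<Rightarrow> real" where
  "infovar W q x = (\<Sum>y\<in>UNIV. W x y * (infodens W q x y - relent (W x) q)\<^sup>2)"

lemma infovar_nonneg: "is_channel W \<Longrightarrow> 0 \<le> infovar W q x"
  unfolding infovar_def by (intro sum_nonneg mult_nonneg_nonneg) (auto intro: channel_nonneg)

lemma dispersion_eq: "dispersion P W = (\<Sum>x\<in>UNIV. P x * infovar W (outdist P W) x)"
  unfolding dispersion_def infovar_def infodens_def
  by (intro sum.cong arg_cong2[where f = "(*)"] refl) auto

text \<open>Since achievers share one output distribution, the dispersion is linear in the achiever
  with fixed nonnegative coefficients. Boundedness is what gives the real \<open>Sup\<close> and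
  \<open>Inf\<close> in \<open>Vplus\<close> and \<open>Vminus\<close> their meaning.\<close>

lemma bdd_dispersion:
  assumes W: "is_channel W" and ex: "\<exists>P. is_dist P \<and> expcost P c \<le> K"
  shows "bdd_above ((\<lambda>P. dispersion P W) ` cap_achievers W c K)"
    and "bdd_below ((\<lambda>P. dispersion P W) ` cap_achievers W c K)"
proof -
  obtain P where P: "P \<in> cap_achievers W c K" using capacity_attained(1)[OF W ex] by auto
  have eq: "dispersion Q W = (\<Sum>x\<in>UNIV. Q x * infovar W (outdist P W) x)" "is_dist Q"
    if "Q \<in> cap_achievers W c K" for Q
    using that cap_achievers_same_outdist[OF W ex P that] by (auto simp: dispersion_eq cap_achievers_def)
  have "dispersion Q W \<le> (\<Sum>x\<in>UNIV. infovar W (outdist P W) x)" if "Q \<in> cap_achievers W c K" for Q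
    unfolding eq(1)[OF that]
    using dist_le_1[OF eq(2)[OF that]] infovar_nonneg[OF W] by (intro sum_mono mult_left_le_one_le)
      (auto intro: dist_nonneg[OF eq(2)[OF that]])
  then show "bdd_above ((\<lambda>P. dispersion P W) ` cap_achievers W c K)"
    by (intro bdd_aboveI2)
  have "0 \<le> dispersion Q W" if "Q \<in> cap_achievers W c K" for Q
    unfolding eq(1)[OF that]
    using infovar_nonneg[OF W] by (intro sum_nonneg mult_nonneg_nonneg) (auto intro: dist_nonneg[OF eq(2)[OF that]])
  then show "bdd_below ((\<lambda>P. dispersion P W) ` cap_achievers W c K)"
    by (intro bdd_belowI2)
qed

subsection \<open>A countable family of reference output distributions\<close>

text \<open>Enumerates the normalised positive rational functions; every other index yields the
  uniform distribution. Thus each member is strictly positive, and likelihood tests against it need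
  no condition on supports.\<close>

definition refdist :: "nat \<Rightarrow> 'y::finite \<Rightarrow> real" where
  "refdist j y = (let f = from_nat j :: 'y \<Rightarrow> rat in
     if \<forall>y. 0 < f y then real_of_rat (f y) / (\<Sum>y\<in>UNIV. real_of_rat (f y)) else 1 / real CARD('y))"

lemma refdist_pos: "0 < refdist j y"
  unfolding refdist_def Let_def
  by (auto intro!: divide_pos_pos sum_pos simp: zero_less_card_finite)

lemma refdist_sum: "(\<Sum>y\<in>UNIV. refdist j (y :: 'y::finite)) = 1"
proof (cases "\<forall>y. 0 < (from_nat j :: 'y \<Rightarrow> rat) y")
  case True
  then have "0 < (\<Sum>y\<in>UNIV. real_of_rat ((from_nat j :: 'y \<Rightarrow> rat) y))"
    by (intro sum_pos) auto
  with True show ?thesis by (simp add: refdist_def Let_def sum_divide_distrib[symmetric])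
next
  case False
  then have "refdist j y = 1 / real CARD('y)" for y :: 'y
    unfolding refdist_def Let_def by (rule if_not_P)
  then show ?thesis by simp
qed

text \<open>Rationals are taken slightly above the output probabilities. Normalising then divides by
  at most \<open>1 + \<delta>\<close>, so the reference dominates
  \<open>r y / (1 + \<delta>)\<close> and the averaged divergence exceeds \<open>mutinf Q W\<close>
  by at most \<open>ln (1 + \<delta>)\<close>.\<close>

lemma refdist_approx:
  fixes W :: "'x::finite \<Rightarrow> 'y::finite \<Rightarrow> real"
  assumes W: "is_channel W" and Q: "is_dist Q" and lt: "mutinf Q W < C"
  shows "\<exists>j. (\<Sum>x\<in>UNIV. Q x * relent (W x) (refdist j)) < C"
proof -
  \<comment> \<open>Chosen so that \<open>ln (1 + \<delta>)\<close> is half of the gap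
    \<open>C - mutinf Q W\<close>.\<close>
  define \<delta> where "\<delta> = exp ((C - mutinf Q W) / 2) - 1"
  define r where "r = outdist Q W"
  have \<delta>: "0 < \<delta>" using lt by (simp add: \<delta>_def)
  have r0: "0 \<le> r y" for y using outdist_nonneg W Q by (auto simp: r_def)
  have "\<exists>f. r y < real_of_rat f \<and> real_of_rat f < r y + \<delta> / CARD('y)" for y
    using of_rat_dense[of "r y" "r y + \<delta> / CARD('y)"] \<delta> by (simp add: zero_less_card_finite)
  then obtain f where f: "\<And>y. r y < real_of_rat (f y)" "\<And>y. real_of_rat (f y) < r y + \<delta> / CARD('y)"
    by metis
  have fpos: "0 < f y" for y using f(1)[of y] r0[of y] by (smt (verit) zero_less_of_rat_iff)
  define T where "T = (\<Sum>y\<in>UNIV. real_of_rat (f y))"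
  have "T \<le> (\<Sum>y\<in>UNIV. r y + \<delta> / CARD('y))"
    unfolding T_def using f(2) by (intro sum_mono less_imp_le)
  also have "\<dots> = 1 + \<delta>" using outdist_sum W Q by (simp add: sum.distrib r_def)
  finally have T: "T \<le> 1 + \<delta>" .
  have T0: "0 < T" unfolding T_def using fpos by (intro sum_pos) auto
  define j where "j = to_nat f"
  have ref: "refdist j y = real_of_rat (f y) / T" for y
    using fpos by (simp add: refdist_def j_def T_def)
  have "(\<Sum>x\<in>UNIV. Q x * relent (W x) (refdist j))
      = (\<Sum>x\<in>UNIV. Q x * negent W x) - (\<Sum>y\<in>UNIV. r y * ln (refdist j y))"
    unfolding r_def by (rule sum_relent[OF W Q refdist_pos])
  also have "\<dots> \<le> (\<Sum>x\<in>UNIV. Q x * negent W x) - (\<Sum>y\<in>UNIV. r y * ln (r y) - r y * ln (1 + \<delta>))"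
  proof (intro diff_left_mono sum_mono)
    fix y
    show "r y * ln (r y) - r y * ln (1 + \<delta>) \<le> r y * ln (refdist j y)"
    proof (cases "r y = 0")
      case False
      then have "0 < r y" using r0[of y] by simp
      moreover have "r y / (1 + \<delta>) \<le> refdist j y"
        unfolding ref using f(1)[of y] T T0 \<delta> r0[of y] fpos[of y] by (intro frac_le) auto
      ultimately have "ln (r y / (1 + \<delta>)) \<le> ln (refdist j y)"
        using \<delta> by (subst ln_le_cancel_iff) (auto simp: refdist_pos)
      then have "r y * ln (r y / (1 + \<delta>)) \<le> r y * ln (refdist j y)"
        using \<open>0 < r y\<close> by simp
      then show ?thesis using \<open>0 < r y\<close> \<delta> by (simp add: ln_div algebra_simps)
    qed simp
  qed
  also have "\<dots> = mutinf Q W + ln (1 + \<delta>)"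
    using mutinf_eq[OF W Q] outdist_sum[OF W Q]
    by (simp add: r_def sum_subtractf sum_distrib_right[symmetric])
  also have "\<dots> < C" using lt by (simp add: \<delta>_def field_simps)
  finally show ?thesis by blast
qed

subsection \<open>Types of codewords\<close>

lemma sum_nth_eq_sum_count:
  fixes f :: "'x::finite \<Rightarrow> real"
  shows "(\<Sum>i<length xs. f (xs ! i)) = (\<Sum>x\<in>UNIV. real (count_list xs x) * f x)"
proof (induction xs)
  case (Cons a xs)
  have "(\<Sum>x\<in>UNIV. real (count_list (a # xs) x) * f x)
      = (\<Sum>x\<in>UNIV. real (count_list xs x) * f x + (if a = x then f x else 0))"
    by (intro sum.cong) (auto simp: algebra_simps)
  also have "\<dots> = f a + (\<Sum>x\<in>UNIV. real (count_list xs x) * f x)"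
    by (simp add: sum.distrib)
  finally show ?case
    using Cons by (simp add: sum.lessThan_Suc_shift del: sum.lessThan_Suc)
qed simp

definition empdist :: "'x list \<Rightarrow> 'x \<Rightarrow> real" where
  "empdist xs x = real (count_list xs x) / real (length xs)"

lemma sum_nth_eq_empdist:
  fixes f :: "'x::finite \<Rightarrow> real"
  shows "(\<Sum>i<length xs. f (xs ! i)) = real (length xs) * (\<Sum>x\<in>UNIV. empdist xs x * f x)"
  unfolding sum_nth_eq_sum_count sum_distrib_left by (intro sum.cong) (auto simp: empdist_def)

lemma empdist_pos: "x \<in> set xs \<Longrightarrow> 0 < empdist xs x"
  unfolding empdist_def using count_list_0_iff[of xs x]
  by (intro divide_pos_pos) (auto intro: length_pos_if_in_set)

lemma empdist_feasible:
  assumes "xs \<in> cost_constrained c K n" "0 < n"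
  shows "is_dist (empdist xs)" "expcost (empdist xs) c \<le> K"
proof -
  have n: "length xs = n" and cost: "(\<Sum>i<n. c (xs ! i)) \<le> n * K"
    using assms by (auto simp: cost_constrained_def)
  show "is_dist (empdist xs)"
    using sum_nth_eq_empdist[of "\<lambda>_. 1" xs] assms(2) n by (auto simp: is_dist_def empdist_def)
  show "expcost (empdist xs) c \<le> K"
    using sum_nth_eq_empdist[of c xs] cost assms(2) n by (simp add: expcost_def)
qed

definition centered :: "('x \<Rightarrow> 'y::finite \<Rightarrow> real) \<Rightarrow> ('y \<Rightarrow> real) \<Rightarrow> 'x \<Rightarrow> 'y \<Rightarrow> real" where
  "centered W q x y = infodens W q x y - relent (W x) q"

lemma centered_mean:
  assumes "is_channel W"
  shows "(\<Sum>y\<in>UNIV. W x y * centered W q x y) = 0"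
  by (simp add: centered_def right_diff_distrib sum_subtractf sum_distrib_right[symmetric]
      channel_sum[OF assms] relent_infodens)

lemma infovar_centered: "infovar W q x = (\<Sum>y\<in>UNIV. W x y * (centered W q x y)\<^sup>2)"
  by (simp add: infovar_def centered_def)

text \<open>Fluctuation plus mean; the mean depends on the word only through its type.\<close>

lemma additive_infodens:
  fixes W :: "'x::finite \<Rightarrow> 'y::finite \<Rightarrow> real"
  shows "additive (infodens W q) xs ys = additive (centered W q) xs ys
       + real (length xs) * (\<Sum>x\<in>UNIV. empdist xs x * relent (W x) q)"
  using sum_nth_eq_empdist[of "\<lambda>x. relent (W x) q" xs]
  by (simp add: additive_def centered_def sum_subtractf)

subsection \<open>Converse\<close>

text \<open>Each message may use the reference distribution that suits its codeword best, at the price of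
  a factor \<open>card J\<close>, since the decoding sets have total mass at most \<open>1\<close> under each reference.\<close>
lemma meta_converse:
  fixes W :: "'x::finite \<Rightarrow> 'y::finite \<Rightarrow> real"
  assumes W: "is_channel W" and code: "is_code n (N, \<phi>, D)" and J: "finite J"
    and q: "\<And>j y. j \<in> J \<Longrightarrow> 0 \<le> q j y" "\<And>j. j \<in> J \<Longrightarrow> (\<Sum>y\<in>UNIV. q j y) = 1"
    and p: "\<And>i. i \<in> {1..N} \<Longrightarrow> \<exists>j\<in>J. p \<le> chan_prob W (\<phi> i)
              {ys. length ys = n \<and> prodchan W (\<phi> i) ys \<le> exp \<gamma> * (\<Prod>k<n. q j (ys ! k))}"
  shows "p - real (card J) * exp \<gamma> / real N \<le> err_prob W (N, \<phi>, D)"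
proof -
  define qn where "qn j ys = (\<Prod>k<n. q j (ys ! k))" for j ys
  \<comment> \<open>One measure of total mass \<open>card J\<close> dominating all references, so
    that the disjoint decoding sets share a single budget although \<open>j\<close> varies with the
    message.\<close>
  define R where "R ys = (\<Sum>j\<in>J. qn j ys)" for ys
  have N: "1 \<le> N" and len: "\<And>i. i \<in> {1..N} \<Longrightarrow> length (\<phi> i) = n"
    and Dsub: "\<And>i. i \<in> {1..N} \<Longrightarrow> D i \<subseteq> {ys. length ys = n}"
    and disj: "\<And>i j. i \<in> {1..N} \<Longrightarrow> j \<in> {1..N} \<Longrightarrow> i \<noteq> j \<Longrightarrow> D i \<inter> D j = {}"
    using code by (auto simp: is_code_def)
  have finD: "finite (D i)" if "i \<in> {1..N}" for i
    by (rule finite_subset[OF Dsub[OF that] finite_words])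
  have qn0: "0 \<le> qn j ys" if "j \<in> J" for j ys
    unfolding qn_def using q(1)[OF that] by (intro prod_nonneg) auto
  have R0: "0 \<le> R ys" for ys unfolding R_def using qn0 by (intro sum_nonneg)
  have one: "p - exp \<gamma> * (\<Sum>ys\<in>D i. R ys) \<le> 1 - chan_prob W (\<phi> i) (D i)" if i: "i \<in> {1..N}" for i
  proof -
    obtain j where j: "j \<in> J" and pj: "p \<le> chan_prob W (\<phi> i)
              {ys. length ys = n \<and> prodchan W (\<phi> i) ys \<le> exp \<gamma> * qn j ys}"
      using p[OF i] by (auto simp: qn_def)
    define E where "E = {ys. length ys = n \<and> prodchan W (\<phi> i) ys \<le> exp \<gamma> * qn j ys}"
    have finE: "finite E"
      by (rule finite_subset[OF _ finite_words[of n]]) (auto simp: E_def)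
    \<comment> \<open>On \<open>E\<close> the channel probability is at most
      \<open>exp \<gamma> * R\<close>. What \<open>D i\<close> collects outside \<open>E\<close> is
      limited by the total mass 1, hence by \<open>1 - p\<close>.\<close>
    have "chan_prob W (\<phi> i) (D i) = chan_prob W (\<phi> i) (D i \<inter> E) + chan_prob W (\<phi> i) (D i - E)"
      unfolding chan_prob_def using finD[OF i] by (subst sum.union_disjoint[symmetric])
        (auto intro!: arg_cong2[where f = sum])
    moreover have "chan_prob W (\<phi> i) E + chan_prob W (\<phi> i) (D i - E) = chan_prob W (\<phi> i) (E \<union> (D i - E))"
      unfolding chan_prob_def using finD[OF i] finE by (subst sum.union_disjoint) auto
    moreover have "chan_prob W (\<phi> i) (E \<union> (D i - E)) \<le> 1"
      using Dsub[OF i] len[OF i] by (intro chan_prob_le_1[OF W]) (auto simp: E_def)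
    moreover have "chan_prob W (\<phi> i) (D i \<inter> E) \<le> (\<Sum>ys\<in>D i \<inter> E. exp \<gamma> * R ys)"
      unfolding chan_prob_def
    proof (rule sum_mono)
      fix ys assume "ys \<in> D i \<inter> E"
      then have "prodchan W (\<phi> i) ys \<le> exp \<gamma> * qn j ys" by (auto simp: E_def)
      also have "\<dots> \<le> exp \<gamma> * R ys"
        unfolding R_def using qn0 j J by (intro mult_left_mono member_le_sum) auto
      finally show "prodchan W (\<phi> i) ys \<le> exp \<gamma> * R ys" .
    qed
    moreover have "(\<Sum>ys\<in>D i \<inter> E. exp \<gamma> * R ys) \<le> (\<Sum>ys\<in>D i. exp \<gamma> * R ys)"
      using R0 finD[OF i] by (intro sum_mono2) auto
    ultimately show ?thesis
      using pj unfolding E_def[symmetric] sum_distrib_left by linarith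
  qed
  have "(\<Sum>i\<in>{1..N}. \<Sum>ys\<in>D i. R ys) = (\<Sum>ys\<in>(\<Union>i\<in>{1..N}. D i). R ys)"
    using disj finD by (subst sum.UNION_disjoint) auto
  also have "\<dots> \<le> (\<Sum>ys | length ys = n. R ys)"
    using Dsub R0 by (intro sum_mono2 UN_least) auto
  also have "\<dots> = (\<Sum>j\<in>J. \<Sum>ys | length ys = n. qn j ys)"
    unfolding R_def by (rule sum.swap)
  also have "\<dots> = card J"
    unfolding qn_def sum_words_prod_const using q(2) by simp
  finally have mass: "(\<Sum>i\<in>{1..N}. \<Sum>ys\<in>D i. R ys) \<le> card J" .
  have "N * p - exp \<gamma> * card J \<le> (\<Sum>i\<in>{1..N}. p - exp \<gamma> * (\<Sum>ys\<in>D i. R ys))"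
    using mult_left_mono[OF mass, of "exp \<gamma>"] by (simp add: sum_subtractf sum_distrib_left)
  also have "\<dots> \<le> (\<Sum>i=1..N. 1 - chan_prob W (\<phi> i) (D i))"
    by (intro sum_mono one)
  finally have "(N * p - exp \<gamma> * card J) / N \<le> (\<Sum>i=1..N. 1 - chan_prob W (\<phi> i) (D i)) / N"
    by (rule divide_right_mono) simp
  then show ?thesis
    using N by (simp add: err_prob_def diff_divide_distrib mult.commute)
qed

text \<open>For \<open>a \<ge> 0\<close> the larger variance gives the smaller value, for
  \<open>a < 0\<close> the smaller variance does. Taking \<open>min\<close> covers both signs, so
  continuity and strict monotonicity need no case split at 0.\<close>

definition limit_error :: "('x::finite \<Rightarrow> 'y::finite \<Rightarrow> real) \<Rightarrow> ('x \<Rightarrow> real) \<Rightarrow> real \<Rightarrow> real \<Rightarrow> real" where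
  "limit_error W c K a = Gauss (min (a / sqrt (Vplus W c K)) (a / sqrt (Vminus W c K)))"

lemma dispersion_bounds:
  assumes W: "is_channel W" and ex: "\<exists>P. is_dist P \<and> expcost P c \<le> K"
    and P: "P \<in> cap_achievers W c K"
  shows "Vminus W c K \<le> dispersion P W" "dispersion P W \<le> Vplus W c K"
  using bdd_dispersion[OF W ex] P unfolding Vminus_def Vplus_def
  by (auto intro: cInf_lower cSup_upper)

lemma limit_error_le:
  assumes W: "is_channel W" and ex: "\<exists>P. is_dist P \<and> expcost P c \<le> K" and pos: "0 < Vminus W c K"
    and P: "P \<in> cap_achievers W c K"
  shows "limit_error W c K a \<le> Gauss (a / sqrt (dispersion P W))"
proof -
  note V = dispersion_bounds[OF W ex P]
  have "min (a / sqrt (Vplus W c K)) (a / sqrt (Vminus W c K)) \<le> a / sqrt (dispersion P W)"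
  proof (cases "0 \<le> a")
    case True
    then have "a / sqrt (Vplus W c K) \<le> a / sqrt (dispersion P W)"
      using V pos by (intro divide_left_mono) auto
    then show ?thesis by simp
  next
    case False
    then have "a / sqrt (Vminus W c K) \<le> a / sqrt (dispersion P W)"
      using V pos by (intro divide_left_mono_neg) auto
    then show ?thesis by simp
  qed
  then show ?thesis
    unfolding limit_error_def by (simp add: strict_mono_less_eq[OF Gauss_strict_mono])
qed

text \<open>Provides the hypothesis of \<open>meta_converse\<close> for all messages at once. The
  reference may depend on the word, but the bound holds from a length on that does not; this
  uniformity is the reason for arguing by contradiction along a sequence of bad words.\<close>

lemma codeword_information_bound:
  fixes W :: "'x::finite \<Rightarrow> 'y::finite \<Rightarrow> real"
  assumes W: "is_channel W" and ex: "\<exists>P. is_dist P \<and> expcost P c \<le> K" and pos: "0 < Vminus W c K"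
    and P: "P \<in> cap_achievers W c K" and \<eta>: "0 < \<eta>"
  shows "\<forall>\<^sub>F n in sequentially. \<forall>xs\<in>cost_constrained c K n. \<exists>q\<in>insert (outdist P W) (refdist ` {..n}).
    limit_error W c K b - \<eta> \<le> chan_prob W xs {ys. length ys = n \<and>
      prodchan W xs ys \<le> exp (real n * capacity W c K + b * sqrt n) * (\<Prod>k<n. q (ys ! k))}"
    (is "\<forall>\<^sub>F n in _. \<forall>xs\<in>_. ?good n xs")
proof (rule ccontr)
  let ?C = "capacity W c K"
  define G where "G n xs \<longleftrightarrow> ?good n xs" for n xs
  \<comment> \<open>Length 0 is excluded because the type of the empty word is identically zero, not
    a distribution.\<close>
  define S where "S = {n. 0 < n \<and> \<not> (\<forall>xs\<in>cost_constrained c K n. G n xs)}"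
  assume "\<not> ?thesis"
  then have "\<exists>\<^sub>F n in sequentially. \<not> (\<forall>xs\<in>cost_constrained c K n. G n xs)"
    by (simp add: not_eventually G_def)
  from frequently_eventually_conj[OF this eventually_gt_at_top[of 0]]
  have "\<exists>\<^sub>F n in sequentially. n \<in> S"
    unfolding S_def mem_Collect_eq .
  then have "infinite S"
    unfolding cofinite_eq_sequentially[symmetric] frequently_cofinite by simp
  then obtain r0 :: "nat \<Rightarrow> nat" where r0: "strict_mono r0" "\<And>k. r0 k \<in> S"
    using infinite_enumerate by blast
  have "\<exists>xs. xs \<in> cost_constrained c K (r0 k) \<and> \<not> G (r0 k) xs" for k
    using r0(2)[of k] by (auto simp: S_def)
  then obtain xs0 where xs0: "\<And>k. xs0 k \<in> cost_constrained c K (r0 k)" "\<And>k. \<not> G (r0 k) (xs0 k)"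
    by metis
  have r0_pos: "0 < r0 k" for k
    using r0(2)[of k] by (simp add: S_def)
  let ?F = "{P. is_dist P \<and> expcost P c \<le> K}"
  have "\<forall>k. (empdist \<circ> xs0) k \<in> ?F"
    using empdist_feasible[OF xs0(1) r0_pos] by simp
  then obtain Q and r1 :: "nat \<Rightarrow> nat" where Q: "Q \<in> ?F" and r1: "strict_mono r1"
      and lim: "(empdist \<circ> xs0 \<circ> r1) \<longlonglongrightarrow> Q"
    by (rule seq_compactE[OF compact_imp_seq_compact[OF compact_feasible[of c K]]])
  define xs where "xs = xs0 \<circ> r1"
  define r where "r = r0 \<circ> r1"
  have r: "strict_mono r" unfolding r_def using r0(1) r1 by (rule strict_mono_o)
  have r_pos: "0 < r k" and xs: "xs k \<in> cost_constrained c K (r k)" and bad: "\<not> ?good (r k) (xs k)" for k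
    using r0_pos xs0 by (auto simp: r_def xs_def G_def)
  have len: "length (xs k) = r k" for k using xs[of k] by (auto simp: cost_constrained_def)
  have Qk: "is_dist (empdist (xs k))" "expcost (empdist (xs k)) c \<le> K" for k
    using empdist_feasible[OF xs r_pos] by auto
  have lim_x: "(\<lambda>k. empdist (xs k) x) \<longlonglongrightarrow> Q x" for x
    using continuous_on_tendsto_compose[OF continuous_on_product_coordinates[of x] lim]
    by (simp add: xs_def o_def)
  have lim_sum: "(\<lambda>k. \<Sum>x\<in>UNIV. empdist (xs k) x * f x) \<longlonglongrightarrow> (\<Sum>x\<in>UNIV. Q x * f x)" for f
    by (intro tendsto_intros lim_x)
  have r_top: "filterlim r at_top sequentially" by (rule filterlim_subseq[OF r])
  have rr_top: "filterlim (\<lambda>k. real (r k)) at_top sequentially"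
    by (rule filterlim_compose[OF filterlim_real_sequentially r_top])
  have Qd: "is_dist Q" "expcost Q c \<le> K" using Q by auto
  have QC: "mutinf Q W \<le> ?C" by (rule capacity_attained(2)[OF W ex Qd])
  have not_good: "chan_prob W (xs k) {ys. length ys = length (xs k) \<and>
        additive (infodens W q) (xs k) ys \<le> r k * ?C + b * sqrt (r k)} < limit_error W c K b - \<eta>"
    if "q \<in> insert (outdist P W) (refdist ` {..r k})"
      and "\<And>x y. x \<in> set (xs k) \<Longrightarrow> 0 < W x y \<Longrightarrow> 0 < q y" for k q
  proof -
    have "\<not> limit_error W c K b - \<eta> \<le> chan_prob W (xs k) {ys. length ys = r k \<and>
      prodchan W (xs k) ys \<le> exp (real (r k) * ?C + b * sqrt (r k)) * (\<Prod>i<r k. q (ys ! i))}"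
      using bad[of k] that(1) by blast
    then show ?thesis
      using chan_prob_likelihood_ratio[where xs = "xs k" and q = q and \<gamma> = "r k * ?C + b * sqrt (r k)", OF W that(2)]
      by (simp add: len)
  qed
  show False
  proof (cases "mutinf Q W = ?C")
    case True
    then have Qa: "Q \<in> cap_achievers W c K" using Qd by (simp add: cap_achievers_def)
    define q where "q = outdist P W"
    have disp: "dispersion Q W = (\<Sum>x\<in>UNIV. Q x * infovar W q x)"
      using cap_achievers_same_outdist[OF W ex P Qa] by (simp add: dispersion_eq q_def)
    have V: "0 < dispersion Q W" using dispersion_bounds[OF W ex Qa] pos by simp
    have "(\<lambda>k. chan_prob W (xs k) {ys. length ys = length (xs k) \<and>
        additive (centered W q) (xs k) ys \<le> b * sqrt (length (xs k))})
        \<longlonglongrightarrow> Gauss (b / sqrt (dispersion Q W))"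
    proof (rule channel_clt[OF W centered_mean[OF W] _ _ V tendsto_const])
      show "filterlim (\<lambda>k. length (xs k)) at_top sequentially"
        using r_top by (simp add: len)
      have "(\<lambda>k. (\<Sum>i<length (xs k). infovar W q (xs k ! i)) / real (length (xs k)))
          = (\<lambda>k. \<Sum>x\<in>UNIV. empdist (xs k) x * infovar W q x)"
        unfolding sum_nth_eq_empdist unfolding len using r_pos by (auto simp: less_imp_neq[symmetric])
      then show "(\<lambda>k. (\<Sum>i<length (xs k). \<Sum>y\<in>UNIV. W (xs k ! i) y * (centered W q (xs k ! i) y)\<^sup>2)
            / real (length (xs k))) \<longlonglongrightarrow> dispersion Q W"
        using lim_sum[of "infovar W q"] unfolding disp infovar_centered[symmetric] by simp
    qed
    moreover have "chan_prob W (xs k) {ys. length ys = length (xs k) \<and>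
        additive (centered W q) (xs k) ys \<le> b * sqrt (length (xs k))} \<le> limit_error W c K b - \<eta>" for k
    proof -
      \<comment> \<open>Optimality is applied to the actual type of \<open>xs k\<close>, not to the
        limit \<open>Q\<close>. It bounds the mean by \<open>r k * ?C\<close> exactly, whereas the
        limit alone would leave an error \<open>o(n)\<close>, too coarse at scale
        \<open>sqrt n\<close>.\<close>
      note opt = cap_achiever_optimality[OF W ex P Qk[of k]]
      have "chan_prob W (xs k) {ys. length ys = length (xs k) \<and>
          additive (centered W q) (xs k) ys \<le> b * sqrt (length (xs k))}
        \<le> chan_prob W (xs k) {ys. length ys = length (xs k) \<and>
          additive (infodens W q) (xs k) ys \<le> r k * ?C + b * sqrt (r k)}"
      proof (rule chan_prob_mono[OF W])
        show "{ys. length ys = length (xs k) \<and> additive (centered W q) (xs k) ys \<le> b * sqrt (length (xs k))}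
            \<subseteq> {ys. length ys = length (xs k) \<and> additive (infodens W q) (xs k) ys \<le> r k * ?C + b * sqrt (r k)}"
          using mult_left_mono[OF opt(2), of "real (r k)"]
          by (auto simp: additive_infodens len q_def)
      qed auto
      also have "\<dots> < limit_error W c K b - \<eta>"
        using opt(1)[OF empdist_pos] by (intro not_good) (auto simp: q_def)
      finally show ?thesis by simp
    qed
    ultimately have "Gauss (b / sqrt (dispersion Q W)) \<le> limit_error W c K b - \<eta>"
      by (intro LIMSEQ_le_const2) auto
    with limit_error_le[OF W ex pos Qa, of b] \<eta> show False by simp
  next
    case False
    then have "mutinf Q W < ?C" using QC by simp
    then obtain j where j: "(\<Sum>x\<in>UNIV. Q x * relent (W x) (refdist j)) < ?C"
      using refdist_approx[OF W Qd(1)] by blast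
    define q :: "'y \<Rightarrow> real" where "q = refdist j"
    define \<mu> where "\<mu> k = (\<Sum>x\<in>UNIV. empdist (xs k) x * relent (W x) q)" for k
    define \<delta> where "\<delta> = (?C - (\<Sum>x\<in>UNIV. Q x * relent (W x) q)) / 2"
    have \<delta>: "0 < \<delta>" using j by (simp add: \<delta>_def q_def)
    \<comment> \<open>Measured at scale \<open>n\<close>, the offset \<open>b * sqrt n\<close>
      disappears, so the test threshold exceeds the mean by \<open>r k * \<delta>\<close>, with
      \<delta> half of the limiting gap.\<close>
    have "(\<lambda>k. ?C - \<mu> k + b / sqrt (r k)) \<longlonglongrightarrow> ?C - (\<Sum>x\<in>UNIV. Q x * relent (W x) q) + 0"
      unfolding \<mu>_def
      by (intro tendsto_intros lim_sum tendsto_divide_0[OF tendsto_const] filterlim_at_top_imp_at_infinity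
          filterlim_compose[OF sqrt_at_top rr_top])
    moreover have "\<delta> < ?C - (\<Sum>x\<in>UNIV. Q x * relent (W x) q) + 0"
      using \<delta> by (simp add: \<delta>_def field_simps)
    ultimately have ev1: "\<forall>\<^sub>F k in sequentially. \<delta> < ?C - \<mu> k + b / sqrt (r k)"
      by (rule order_tendstoD(1))
    have "(\<lambda>k. (\<Sum>x\<in>UNIV. empdist (xs k) x * infovar W q x) / \<delta>\<^sup>2 * (1 / r k))
        \<longlonglongrightarrow> (\<Sum>x\<in>UNIV. Q x * infovar W q x) / \<delta>\<^sup>2 * 0"
      using \<delta> by (intro tendsto_mult tendsto_divide lim_sum tendsto_const tendsto_divide_0[OF tendsto_const]
          filterlim_at_top_imp_at_infinity rr_top) auto
    then have ev2: "\<forall>\<^sub>F k in sequentially. (\<Sum>x\<in>UNIV. empdist (xs k) x * infovar W q x) / \<delta>\<^sup>2 * (1 / r k) < \<eta>"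
      using \<eta> by (intro order_tendstoD(2)) auto
    have ev3: "\<forall>\<^sub>F k in sequentially. j \<le> r k"
      using r_top by (simp add: filterlim_at_top)
    from ev1 ev2 ev3 have "\<forall>\<^sub>F k in sequentially. False"
    proof eventually_elim
      case (elim k)
      have sq: "sqrt (r k) * sqrt (r k) = r k" by simp
      have "r k * \<delta> < r k * (?C - \<mu> k + b / sqrt (r k))"
        using elim(1) r_pos[of k] by simp
      also have "\<dots> = r k * (?C - \<mu> k) + b * sqrt (r k)"
        using r_pos[of k] sq by (simp add: field_simps)
      finally have thr: "r k * \<delta> < r k * (?C - \<mu> k) + b * sqrt (r k)" .
      have "1 - chan_prob W (xs k) {ys. length ys = length (xs k) \<and>
            additive (infodens W q) (xs k) ys \<le> r k * ?C + b * sqrt (r k)}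
          = chan_prob W (xs k) {ys. length ys = length (xs k) \<and>
            \<not> additive (infodens W q) (xs k) ys \<le> r k * ?C + b * sqrt (r k)}"
        by (simp add: chan_prob_compl[OF W])
      also have "\<dots> \<le> chan_prob W (xs k) {ys. length ys = length (xs k) \<and>
            r k * \<delta> < additive (centered W q) (xs k) ys}"
      proof (rule chan_prob_mono[OF W])
        show "{ys. length ys = length (xs k) \<and> \<not> additive (infodens W q) (xs k) ys \<le> r k * ?C + b * sqrt (r k)}
            \<subseteq> {ys. length ys = length (xs k) \<and> r k * \<delta> < additive (centered W q) (xs k) ys}"
          using thr by (auto simp: additive_infodens len \<mu>_def[symmetric] right_diff_distrib)
      qed auto
      also have "\<dots> \<le> (\<Sum>i<length (xs k). \<Sum>y\<in>UNIV. W (xs k ! i) y * (centered W q (xs k ! i) y)\<^sup>2) / (r k * \<delta>)\<^sup>2"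
        using \<delta> r_pos[of k] by (intro additive_chebyshev[OF W centered_mean[OF W]]) auto
      also have "\<dots> = (\<Sum>x\<in>UNIV. empdist (xs k) x * infovar W q x) / \<delta>\<^sup>2 * (1 / r k)"
        unfolding infovar_centered[symmetric] sum_nth_eq_empdist unfolding len
        using r_pos[of k] \<delta> by (simp add: field_simps power2_eq_square)
      also note elim(2)
      finally have "1 - \<eta> < chan_prob W (xs k) {ys. length ys = length (xs k) \<and>
            additive (infodens W q) (xs k) ys \<le> r k * ?C + b * sqrt (r k)}" by simp
      also have "\<dots> < limit_error W c K b - \<eta>"
        using elim(3) by (intro not_good) (auto simp: q_def refdist_pos)
      finally show False
        using Gauss_less_1 by (simp add: limit_error_def) (smt (verit) Gauss_less_1)
    qed
    then show False by simp
  qed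
qed

lemma isCont_limit_error: "isCont (limit_error W c K) a"
proof -
  have "isCont (\<lambda>a. Gauss (min (a / sqrt (Vplus W c K)) (a / sqrt (Vminus W c K)))) a"
    unfolding divide_inverse by (intro isCont_o2[OF _ isCont_Gauss] continuous_intros)
  then show ?thesis by (simp add: limit_error_def[abs_def])
qed

theorem converse:
  fixes W :: "'x::finite \<Rightarrow> 'y::finite \<Rightarrow> real"
  assumes W: "is_channel W" and ex: "\<exists>P. is_dist P \<and> expcost P c \<le> K" and pos: "0 < Vminus W c K"
    and adm: "admissible_codes c K \<Phi>"
    and rate: "ereal a \<le> liminf (\<lambda>n. ereal (second_order W c K \<Phi> n))"
  shows "ereal (limit_error W c K a) \<le> limsup (\<lambda>n. ereal (err_prob W (\<Phi> n)))"
proof (rule dense_le)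
  let ?C = "capacity W c K"
  fix L' assume L': "L' < ereal (limit_error W c K a)"
  show "L' \<le> limsup (\<lambda>n. ereal (err_prob W (\<Phi> n)))"
  proof (cases L')
    case (real L)
    have "(limit_error W c K \<longlongrightarrow> limit_error W c K a) (at_left a)"
      using isCont_limit_error[of a W c K] by (simp add: isCont_def filterlim_at_split)
    then have "\<forall>\<^sub>F b in at_left a. L < limit_error W c K b"
      using L' real by (intro order_tendstoD(1)) auto
    moreover have "\<forall>\<^sub>F b in at_left a. b < a"
      by (simp add: eventually_at_filter)
    ultimately have "\<forall>\<^sub>F b in at_left a. b < a \<and> L < limit_error W c K b"
      by eventually_elim simp
    then have "\<exists>b. b < a \<and> L < limit_error W c K b"
      by (rule eventually_happens'[rotated]) simp
    then obtain b where b: "b < a" "L < limit_error W c K b" by blast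
    define \<eta> where "\<eta> = (limit_error W c K b - L) / 2"
    \<comment> \<open>The code has rate above \<open>b'\<close> while the test uses the threshold
      \<open>b\<close>; the resulting factor \<open>exp (- ((b' - b) * sqrt n))\<close> outweighs
      the at most \<open>n + 2\<close> references.\<close>
    define b' where "b' = (a + b) / 2"
    have \<eta>: "0 < \<eta>" and b': "b < b'" "b' < a" using b by (auto simp: \<eta>_def b'_def)
    obtain P where P: "P \<in> cap_achievers W c K" using capacity_attained(1)[OF W ex] by auto
    have "ereal b' < liminf (\<lambda>n. ereal (second_order W c K \<Phi> n))"
      using b' by (intro order.strict_trans2[OF _ rate]) simp
    then have ev1: "\<forall>\<^sub>F n in sequentially. b' < second_order W c K \<Phi> n"
      using less_LiminfD by fastforce
    have "(\<lambda>n. (real n + 2) * exp (- ((b' - b) * sqrt n))) \<longlonglongrightarrow> 0"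
      using b' by real_asymp
    then have ev2: "\<forall>\<^sub>F n in sequentially. (real n + 2) * exp (- ((b' - b) * sqrt n)) < \<eta>"
      using \<eta> by (rule order_tendstoD(2))
    note ev3 = codeword_information_bound[OF W ex pos P \<eta>, of b]
    have "\<forall>\<^sub>F n in sequentially. ereal L \<le> ereal (err_prob W (\<Phi> n))"
      using ev1 ev2 ev3 eventually_gt_at_top[of 0]
    proof eventually_elim
      case (elim n)
      obtain N \<phi> D where \<Phi>: "\<Phi> n = (N, \<phi>, D)" by (cases "\<Phi> n")
      have code: "is_code n (N, \<phi>, D)" and supp: "\<phi> ` {1..N} \<subseteq> cost_constrained c K n"
        using adm[unfolded admissible_codes_def, rule_format, of n] by (simp_all add: \<Phi> code_supp_def)
      have N: "0 < real N" using code by (simp add: is_code_def)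
      let ?J = "insert (outdist P W) (refdist ` {..n})"
      have Pd: "is_dist P" using P by (simp add: cap_achievers_def)
      have "limit_error W c K b - \<eta> - card ?J * exp (real n * ?C + b * sqrt n) / N \<le> err_prob W (N, \<phi>, D)"
      proof (rule meta_converse[OF W code, where q = "\<lambda>q. q"])
        show "0 \<le> q y" if "q \<in> ?J" for q y
          using that outdist_nonneg[OF W Pd] refdist_pos by (auto intro: less_imp_le)
        show "(\<Sum>y\<in>UNIV. q y) = 1" if "q \<in> ?J" for q
          using that outdist_sum[OF W Pd] refdist_sum by auto
        show "\<exists>q\<in>?J. limit_error W c K b - \<eta> \<le> chan_prob W (\<phi> i) {ys. length ys = n \<and>
            prodchan W (\<phi> i) ys \<le> exp (real n * ?C + b * sqrt n) * (\<Prod>k<n. q (ys ! k))}"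
          if "i \<in> {1..N}" for i
          using elim(3) supp that by blast
      qed simp
      moreover have "card ?J * exp (real n * ?C + b * sqrt n) / N < \<eta>"
      proof -
        have "real n * ?C + b' * sqrt n < ln N"
          using elim(1,4) \<Phi> by (simp add: second_order_def code_size_def field_simps)
        then have "exp (real n * ?C + b' * sqrt n) < N"
          using N by (metis exp_less_cancel_iff exp_ln)
        then have "exp (real n * ?C + b * sqrt n) / N \<le> exp (real n * ?C + b * sqrt n) / exp (real n * ?C + b' * sqrt n)"
          by (intro divide_left_mono) (use N in auto)
        also have "\<dots> = exp (- ((b' - b) * sqrt n))"
          by (simp add: exp_diff[symmetric] algebra_simps)
        finally have "exp (real n * ?C + b * sqrt n) / N \<le> exp (- ((b' - b) * sqrt n))" .
        moreover have "card ?J \<le> n + 2"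
          using card_insert_le_m1[of "n + 2" "refdist ` {..n}"] card_image_le[of "{..n}" refdist]
          by simp
        then have "real (card ?J) \<le> real n + 2" by linarith
        ultimately have "card ?J * (exp (real n * ?C + b * sqrt n) / N) \<le> (real n + 2) * exp (- ((b' - b) * sqrt n))"
          by (intro mult_mono) auto
        with elim(2) show ?thesis by simp
      qed
      moreover have "limit_error W c K b - \<eta> - \<eta> = L" by (simp add: \<eta>_def field_simps)
      ultimately show ?case by (simp add: \<Phi>)
    qed
    then have "ereal L \<le> liminf (\<lambda>n. ereal (err_prob W (\<Phi> n)))"
      by (rule Liminf_bounded)
    also have "\<dots> \<le> limsup (\<lambda>n. ereal (err_prob W (\<Phi> n)))"
      by (rule Liminf_le_Limsup) simp
    finally show ?thesis by (simp add: real)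
  qed (use L' in auto)
qed

subsection \<open>Type classes\<close>

definition typeclass :: "('x \<Rightarrow> nat) \<Rightarrow> 'x list set" where
  "typeclass m = {xs. \<forall>x. count_list xs x = m x}"

lemma length_typeclass:
  fixes m :: "'x::finite \<Rightarrow> nat"
  assumes "xs \<in> typeclass m"
  shows "length xs = (\<Sum>x\<in>UNIV. m x)"
proof -
  have "real (length xs) = (\<Sum>x\<in>UNIV. real (count_list xs x))"
    using sum_nth_eq_sum_count[of "\<lambda>_. 1" xs] by simp
  then show ?thesis
    using assms by (simp add: typeclass_def flip: of_nat_sum)
qed

lemma typeclass_permutations:
  fixes m :: "'x::finite \<Rightarrow> nat"
  shows "typeclass m = permutations_of_multiset (\<Sum>x\<in>UNIV. replicate_mset (m x) x)"
proof -
  have "count (\<Sum>x\<in>UNIV. replicate_mset (m x) x) y = m y" for y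
    by (simp add: count_sum)
  then show ?thesis
    by (auto simp: typeclass_def permutations_of_multiset_def multiset_eq_iff count_mset)
qed

lemma typeclass_nonempty: "typeclass (m :: 'x::finite \<Rightarrow> nat) \<noteq> {}"
  unfolding typeclass_permutations by simp

lemma finite_typeclass: "finite (typeclass (m :: 'x::finite \<Rightarrow> nat))"
  unfolding typeclass_permutations by simp

lemma card_typeclass:
  fixes m :: "'x::finite \<Rightarrow> nat"
  shows "card (typeclass m) * (\<Prod>x\<in>UNIV. fact (m x)) = (fact (\<Sum>x\<in>UNIV. m x) :: nat)"
proof -
  define A where "A = (\<Sum>x\<in>UNIV. replicate_mset (m x) x)"
  have count: "count A y = m y" for y
    unfolding A_def by (simp add: count_sum)
  have "(\<Prod>x\<in>set_mset A. fact (count A x)) = (\<Prod>x\<in>UNIV. fact (count A x) :: nat)"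
    by (intro prod.mono_neutral_left) (auto simp: not_in_iff)
  moreover have "size A = (\<Sum>x\<in>UNIV. m x)"
    unfolding A_def by (simp add: size_multiset_sum)
  ultimately show ?thesis
    using card_permutations_of_multiset_aux[of A] by (simp add: count typeclass_permutations flip: A_def)
qed

lemma prod_nth_eq_prod_count:
  fixes f :: "'x::finite \<Rightarrow> real"
  shows "(\<Prod>i<length xs. f (xs ! i)) = (\<Prod>x\<in>UNIV. f x ^ count_list xs x)"
proof (induction xs)
  case (Cons a xs)
  have "(\<Prod>x\<in>UNIV. f x ^ count_list (a # xs) x)
      = (\<Prod>x\<in>UNIV. (if a = x then f x else 1) * f x ^ count_list xs x)"
    by (intro prod.cong) auto
  also have "\<dots> = f a * (\<Prod>x\<in>UNIV. f x ^ count_list xs x)"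
    by (simp add: prod.distrib)
  finally show ?case
    using Cons by (simp add: prod.lessThan_Suc_shift del: prod.lessThan_Suc)
qed simp

text \<open>The Poisson weight \<open>m ^ k / fact k\<close> peaks at \<open>k = m\<close>: the
  ratio of consecutive weights is \<open>m / (k + 1)\<close>.\<close>

lemma power_fact_le: "real m ^ k * fact m \<le> real m ^ m * fact k"
proof (cases "k \<le> m")
  case True
  have "fact m \<le> real m ^ (m - k) * fact k"
  proof -
    have "(fact m :: nat) \<le> m ^ (m - k) * fact k"
      using True mult_right_mono[OF fact_div_fact_le_pow[of "m - k" m], of "fact k"]
        dvd_div_mult_self[OF fact_dvd[OF True, where 'a = nat]] by simp
    then have "real (fact m) \<le> real (m ^ (m - k) * fact k)"
      by (rule of_nat_mono)
    then show ?thesis by simp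
  qed
  then have "real m ^ k * fact m \<le> real m ^ k * (real m ^ (m - k) * fact k)"
    by (intro mult_left_mono) auto
  also have "\<dots> = real m ^ m * fact k"
    using True by (simp add: power_add[symmetric])
  finally show ?thesis .
next
  case False
  have "real m ^ d * fact m \<le> fact (m + d)" for d
  proof (induction d)
    case (Suc d)
    have "real m ^ Suc d * fact m = real m * (real m ^ d * fact m)" by simp
    also have "\<dots> \<le> real (m + Suc d) * fact (m + d)"
      using Suc by (intro mult_mono) auto
    finally show ?case by simp
  qed simp
  from this[of "k - m"] have "real m ^ m * (real m ^ (k - m) * fact m) \<le> real m ^ m * fact k"
    using False by (intro mult_left_mono) auto
  moreover have "real m ^ m * real m ^ (k - m) = real m ^ k"
    using False by (simp add: power_add[symmetric])
  ultimately show ?thesis by (simp add: mult.assoc[symmetric])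
qed

text \<open>Among all types of length \<open>n\<close>, the type \<open>m\<close> has the largest mass under \<open>(m / n)\<^sup>n\<close>.\<close>
lemma typeclass_weight_max:
  fixes m k :: "'x::finite \<Rightarrow> nat"
  assumes "(\<Sum>x\<in>UNIV. k x) = (\<Sum>x\<in>UNIV. m x)"
  shows "real (card (typeclass k)) * (\<Prod>x\<in>UNIV. real (m x) ^ k x)
       \<le> real (card (typeclass m)) * (\<Prod>x\<in>UNIV. real (m x) ^ m x)"
proof -
  have fact_eq: "real (card (typeclass k)) * (\<Prod>x\<in>UNIV. fact (k x)) = real (card (typeclass m)) * (\<Prod>x\<in>UNIV. fact (m x))"
    using card_typeclass[of k] card_typeclass[of m] assms
    by (metis (mono_tags, lifting) of_nat_fact of_nat_mult of_nat_prod prod.cong)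
  define Fk where "Fk = (\<Prod>x\<in>UNIV. fact (k x) :: real)"
  define Fm where "Fm = (\<Prod>x\<in>UNIV. fact (m x) :: real)"
  have pos: "0 < Fk" "0 < Fm" unfolding Fk_def Fm_def by (auto intro: prod_pos)
  have "(\<Prod>x\<in>UNIV. real (m x) ^ k x) * Fm \<le> (\<Prod>x\<in>UNIV. real (m x) ^ m x) * Fk"
    unfolding Fk_def Fm_def prod.distrib[symmetric]
    by (intro prod_mono conjI power_fact_le) auto
  then have "real (card (typeclass k)) * Fk * ((\<Prod>x\<in>UNIV. real (m x) ^ k x) * Fm)
      \<le> real (card (typeclass m)) * Fm * ((\<Prod>x\<in>UNIV. real (m x) ^ m x) * Fk)"
    using fact_eq pos unfolding Fk_def[symmetric] Fm_def[symmetric]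
    by (simp only: mult_left_mono mult_nonneg_nonneg of_nat_0_le_iff less_imp_le)
  then have "(real (card (typeclass k)) * (\<Prod>x\<in>UNIV. real (m x) ^ k x)) * (Fk * Fm)
      \<le> (real (card (typeclass m)) * (\<Prod>x\<in>UNIV. real (m x) ^ m x)) * (Fk * Fm)"
    by (simp only: mult_ac)
  then show ?thesis using pos by (simp add: mult_le_cancel_right)
qed

text \<open>The product distribution of the type has total mass 1, spread over at most
  \<open>(n + 1) ^ CARD('x)\<close> type classes of which its own is the heaviest, and it is
  constant on that class.\<close>

lemma uniform_typeclass_le:
  fixes m :: "'x::finite \<Rightarrow> nat"
  assumes n: "n = (\<Sum>x\<in>UNIV. m x)" "0 < n" and xs: "xs \<in> typeclass m"
  shows "1 / real (card (typeclass m))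
       \<le> real (n + 1) ^ CARD('x) * (\<Prod>i<n. real (m (xs ! i)) / real n)"
proof -
  define f where "f x = real (m x) / real n" for x
  define mass where "mass k = (\<Sum>zs\<in>typeclass k. \<Prod>i<length zs. f (zs ! i))" for k
  have "(\<Sum>x\<in>UNIV. real (m x)) = real n"
    unfolding n(1) by simp
  then have sum_f: "(\<Sum>x\<in>UNIV. f x) = 1"
    unfolding f_def using n(2) by (simp add: sum_divide_distrib[symmetric])
  have mass: "mass k = real (card (typeclass k)) * (\<Prod>x\<in>UNIV. real (m x) ^ k x) / real n ^ n"
    if "(\<Sum>x\<in>UNIV. k x) = n" for k
  proof -
    have "mass k = (\<Sum>zs\<in>typeclass k. \<Prod>x\<in>UNIV. f x ^ k x)"
      unfolding mass_def by (intro sum.cong) (auto simp: prod_nth_eq_prod_count typeclass_def)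
    also have "(\<Prod>x\<in>UNIV. f x ^ k x) = (\<Prod>x\<in>UNIV. real (m x) ^ k x) / real n ^ n"
      by (simp add: f_def power_divide prod_dividef power_sum[symmetric] that)
    finally show ?thesis by simp
  qed
  define T where "T = {k :: 'x \<Rightarrow> nat. (\<forall>x. k x \<le> n) \<and> (\<Sum>x\<in>UNIV. k x) = n}"
  have PiE_eq: "{k :: 'x \<Rightarrow> nat. \<forall>x. k x \<le> n} = PiE UNIV (\<lambda>_. {..n})"
    by (auto simp: PiE_UNIV_domain)
  have finT: "finite T"
    unfolding T_def by (rule finite_subset[of _ "{k. \<forall>x. k x \<le> n}"]) (auto simp: PiE_eq intro!: finite_PiE)
  have "card T \<le> card {k :: 'x \<Rightarrow> nat. \<forall>x. k x \<le> n}"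
    unfolding T_def by (intro card_mono) (auto simp: PiE_eq intro!: finite_PiE)
  also have "\<dots> = (n + 1) ^ CARD('x)"
    unfolding PiE_eq by (simp add: card_PiE)
  finally have cardT: "card T \<le> (n + 1) ^ CARD('x)" .
  have "1 = (\<Sum>zs :: 'x list | length zs = n. \<Prod>i<n. f (zs ! i))"
    by (simp add: sum_words_prod_const sum_f)
  also have "\<dots> \<le> (\<Sum>zs\<in>(\<Union>k\<in>T. typeclass k). \<Prod>i<length zs. f (zs ! i))"
  proof -
    have "{zs :: 'x list. length zs = n} = (\<Union>k\<in>T. typeclass k)"
    proof (intro equalityI subsetI)
      fix zs :: "'x list" assume "zs \<in> {zs. length zs = n}"
      then have "length zs = n" by simp
      moreover have "zs \<in> typeclass (count_list zs)" by (simp add: typeclass_def)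
      moreover have "count_list zs x \<le> length zs" for x by (rule count_le_length)
      ultimately show "zs \<in> (\<Union>k\<in>T. typeclass k)"
        using length_typeclass[of zs "count_list zs"] by (auto simp: T_def)
    qed (auto simp: T_def dest: length_typeclass)
    then show ?thesis by (intro eq_refl sum.cong) auto
  qed
  also have "\<dots> = (\<Sum>k\<in>T. mass k)"
  proof -
    have "typeclass k \<inter> typeclass l = {}" if "k \<noteq> l" for k l :: "'x \<Rightarrow> nat"
      using that by (auto simp: typeclass_def fun_eq_iff)
    then show ?thesis
      unfolding mass_def using finT finite_typeclass by (intro sum.UNION_disjoint) blast+
  qed
  also have "\<dots> \<le> (\<Sum>k\<in>T. mass m)"
  proof (rule sum_mono)
    fix k assume "k \<in> T"
    then have k: "(\<Sum>x\<in>UNIV. k x) = n" by (simp add: T_def)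
    show "mass k \<le> mass m"
      unfolding mass[OF k] mass[OF n(1)[symmetric]]
      using typeclass_weight_max[of k m] k n(1) by (intro divide_right_mono zero_le_power of_nat_0_le_iff) simp
  qed
  also have "\<dots> = card T * mass m" by simp
  also have "\<dots> \<le> real (n + 1) ^ CARD('x) * mass m"
  proof (rule mult_right_mono)
    show "real (card T) \<le> real (n + 1) ^ CARD('x)"
      using cardT by (metis of_nat_le_iff of_nat_power)
    show "0 \<le> mass m"
      unfolding mass_def by (intro sum_nonneg prod_nonneg) (simp add: f_def)
  qed
  finally have 1: "1 \<le> real (n + 1) ^ CARD('x) * mass m" .
  have "mass m = (\<Sum>zs\<in>typeclass m. \<Prod>i<length xs. f (xs ! i))"
    unfolding mass_def using xs by (intro sum.cong) (auto simp: prod_nth_eq_prod_count typeclass_def)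
  then have "mass m = card (typeclass m) * (\<Prod>i<n. f (xs ! i))"
    using length_typeclass[OF xs] n by simp
  with 1 have "1 \<le> card (typeclass m) * (real (n + 1) ^ CARD('x) * (\<Prod>i<n. f (xs ! i)))"
    by (simp add: mult_ac)
  moreover have "0 < card (typeclass m)"
    using typeclass_nonempty[of m] finite_typeclass[of m] by (simp add: card_gt_0_iff)
  ultimately show ?thesis
    unfolding f_def by (simp add: field_simps)
qed

subsection \<open>Rounding an input distribution to a type\<close>

text \<open>All weights are rounded down, except that of a cheapest letter in the support, which takes up
  the slack; this cannot increase the cost.\<close>
lemma round_to_type:
  fixes P :: "'x::finite \<Rightarrow> real" and c :: "'x \<Rightarrow> real" and n :: nat
  assumes P: "is_dist P"
  shows "\<exists>m :: 'x \<Rightarrow> nat. (\<Sum>x\<in>UNIV. m x) = n \<and> (\<Sum>x\<in>UNIV. m x * c x) \<le> n * expcost P c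
      \<and> (\<forall>x. \<bar>m x - n * P x\<bar> \<le> CARD('x)) \<and> (\<forall>x. P x = 0 \<longrightarrow> m x = 0)"
proof -
  have "\<exists>x. P x \<noteq> 0"
    using dist_sum[OF P] by (metis sum.neutral zero_neq_one)
  then obtain x0 where x0: "P x0 \<noteq> 0" "\<And>x. P x \<noteq> 0 \<Longrightarrow> c x0 \<le> c x"
    using ex_is_arg_min_if_finite[of "{x. P x \<noteq> 0}" c] by (auto simp: is_arg_min_linorder)
  define fl where "fl x = nat \<lfloor>n * P x\<rfloor>" for x
  have fl: "real (fl x) \<le> n * P x" "n * P x \<le> fl x + 1" for x
  proof -
    have "real (fl x) = of_int \<lfloor>n * P x\<rfloor>"
      using dist_nonneg[OF P, of x] by (simp add: fl_def of_nat_nat)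
    then show "real (fl x) \<le> n * P x" "n * P x \<le> fl x + 1"
      by linarith+
  qed
  define s where "s = (\<Sum>x\<in>UNIV - {x0}. fl x)"
  have sumP: "(\<Sum>x\<in>UNIV - {x0}. n * P x) = n - n * P x0"
    using dist_sum[OF P] by (simp add: sum_distrib_left[symmetric] sum_diff1 right_diff_distrib)
  have "real s \<le> (\<Sum>x\<in>UNIV - {x0}. n * P x)"
    unfolding s_def of_nat_sum by (intro sum_mono fl)
  then have s_le: "real s \<le> n - n * P x0" using sumP by simp
  moreover have "0 \<le> n * P x0" using dist_nonneg[OF P] by simp
  ultimately have "real s \<le> n" by linarith
  then have sn: "s \<le> n" by simp
  define m where "m x = (if x = x0 then n - s else fl x)" for x
  have m0: "real (m x0) = n - real s" using sn by (simp add: m_def of_nat_diff)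
  have "(\<Sum>x\<in>UNIV. m x) = m x0 + (\<Sum>x\<in>UNIV - {x0}. m x)"
    by (simp add: sum.remove)
  also have "(\<Sum>x\<in>UNIV - {x0}. m x) = s"
    unfolding s_def by (intro sum.cong) (auto simp: m_def)
  finally have sum_m: "(\<Sum>x\<in>UNIV. m x) = n" using sn by (simp add: m_def)
  \<comment> \<open>Away from \<open>x0\<close> the weights only decrease and the costs in the
    support are at least \<open>c x0\<close>. Subtracting \<open>c x0\<close> changes nothing in
    total, because \<open>m\<close> and \<open>n * P\<close> both sum to \<open>n\<close>.\<close>
  have "(\<Sum>x\<in>UNIV. (m x - n * P x) * (c x - c x0)) \<le> 0"
  proof (rule sum_nonpos)
    fix x
    show "(m x - n * P x) * (c x - c x0) \<le> 0"
    proof (cases "x = x0 \<or> P x = 0")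
      case False
      then show ?thesis using x0(2)[of x] fl(1)[of x]
        by (intro mult_nonpos_nonneg) (auto simp: m_def)
    qed (auto simp: m_def fl_def)
  qed
  moreover have "(\<Sum>x\<in>UNIV. (m x - n * P x) * (c x - c x0))
      = (\<Sum>x\<in>UNIV. m x * c x) - n * expcost P c - c x0 * (real (\<Sum>x\<in>UNIV. m x) - n * (\<Sum>x\<in>UNIV. P x))"
    by (simp add: expcost_def algebra_simps sum.distrib sum_subtractf sum_distrib_left)
  ultimately have cost: "(\<Sum>x\<in>UNIV. m x * c x) \<le> n * expcost P c"
    using sum_m dist_sum[OF P] by simp
  have "\<bar>m x - n * P x\<bar> \<le> CARD('x)" for x
  proof (cases "x = x0")
    case True
    \<comment> \<open>The letter \<open>x0\<close> collects the rounding losses of the other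
      letters, each at most 1.\<close>
    have "n - n * P x0 - s = (\<Sum>x\<in>UNIV - {x0}. n * P x - fl x)"
      by (simp add: sum_subtractf sumP s_def)
    also have "\<dots> \<le> (\<Sum>x\<in>UNIV - {x0}. 1)"
      using fl(2) by (intro sum_mono) (simp add: algebra_simps)
    also have "\<dots> \<le> CARD('x)" by (simp add: card_Diff_subset)
    finally show ?thesis using True m0 s_le by auto
  next
    case False
    have "1 \<le> real CARD('x)" by (simp add: Suc_leI)
    moreover have "m x = fl x" using False by (simp add: m_def)
    ultimately show ?thesis using fl[of x] by linarith
  qed
  moreover have "m x = 0" if "P x = 0" for x using that x0(1) by (auto simp: m_def fl_def)
  ultimately show ?thesis using sum_m cost by blast
qed

subsection \<open>Greedy code construction\<close>

text \<open>Feinstein's argument: the decoding sets chosen so far have small \<open>R\<close>-mass, hence small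
  probability on average over \<open>T\<close>, hence are rarely hit from some new codeword.\<close>
lemma greedy_code:
  fixes w :: "'a \<Rightarrow> 'b \<Rightarrow> real"
  assumes T: "finite T" "T \<noteq> {}" and \<Omega>: "finite \<Omega>"
    and w: "\<And>a b. 0 \<le> w a b" and R: "\<And>b. 0 \<le> R b" and \<kappa>: "0 \<le> \<kappa>"
    and A: "\<And>a. a \<in> T \<Longrightarrow> A a \<subseteq> \<Omega>" "\<And>a. a \<in> T \<Longrightarrow> (\<Sum>b\<in>A a. R b) \<le> \<delta>"
    and avg: "\<And>b. b \<in> \<Omega> \<Longrightarrow> (\<Sum>a\<in>T. w a b) / real (card T) \<le> \<kappa> * R b"
  shows "\<exists>\<phi> D. (\<forall>i\<in>{1..M}. \<phi> i \<in> T \<and> D i \<subseteq> A (\<phi> i) \<and>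
              (\<Sum>b\<in>A (\<phi> i). w (\<phi> i) b) - \<kappa> * \<delta> * real (M - 1) \<le> (\<Sum>b\<in>D i. w (\<phi> i) b))
            \<and> (\<forall>i\<in>{1..M}. \<forall>j\<in>{1..M}. i \<noteq> j \<longrightarrow> D i \<inter> D j = {})"
proof (induction M)
  \<comment> \<open>The number of codewords is prescribed and the loss is tracked: the last of
    \<open>M\<close> words competes with \<open>M - 1\<close> earlier decoding sets, each of
    \<open>R\<close>-mass at most \<delta>.\<close>
  case (Suc M)
  have \<delta>: "0 \<le> \<delta>"
    using T A(2) R by (metis ex_in_conv order_trans sum_nonneg)
  from Suc obtain \<phi> D where
    *: "\<forall>i\<in>{1..M}. \<phi> i \<in> T \<and> D i \<subseteq> A (\<phi> i) \<and>
          (\<Sum>b\<in>A (\<phi> i). w (\<phi> i) b) - \<kappa> * \<delta> * real (M - 1) \<le> (\<Sum>b\<in>D i. w (\<phi> i) b)"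
    and **: "\<forall>i\<in>{1..M}. \<forall>j\<in>{1..M}. i \<noteq> j \<longrightarrow> D i \<inter> D j = {}"
    by (elim exE conjE)
  have \<phi>: "\<phi> i \<in> T" "D i \<subseteq> A (\<phi> i)"
      "(\<Sum>b\<in>A (\<phi> i). w (\<phi> i) b) - \<kappa> * \<delta> * real (M - 1) \<le> (\<Sum>b\<in>D i. w (\<phi> i) b)"
    if "i \<in> {1..M}" for i
    using *[rule_format, OF that] by simp_all
  have disj: "D i \<inter> D j = {}" if "i \<in> {1..M}" "j \<in> {1..M}" "i \<noteq> j" for i j
    using **[rule_format, OF that] .
  define U where "U = (\<Union>i\<in>{1..M}. D i)"
  have U: "U \<subseteq> \<Omega>" unfolding U_def using \<phi> A(1) by blast
  have finA: "finite (A a)" if "a \<in> T" for a using A(1)[OF that] \<Omega> finite_subset by blast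
  have finD: "finite (D i)" if "i \<in> {1..M}" for i
    using \<phi>(1,2)[OF that] finA finite_subset by blast
  have "(\<Sum>b\<in>U. R b) = (\<Sum>i\<in>{1..M}. \<Sum>b\<in>D i. R b)"
    unfolding U_def using finD disj by (intro sum.UNION_disjoint) auto
  also have "\<dots> \<le> (\<Sum>i\<in>{1..M}. \<delta>)"
  proof (rule sum_mono)
    fix i assume i: "i \<in> {1..M}"
    have "(\<Sum>b\<in>D i. R b) \<le> (\<Sum>b\<in>A (\<phi> i). R b)"
      using \<phi>[OF i] R finA by (intro sum_mono2) auto
    also have "\<dots> \<le> \<delta>" using \<phi>(1)[OF i] A(2) by blast
    finally show "(\<Sum>b\<in>D i. R b) \<le> \<delta>" .
  qed
  finally have RU: "(\<Sum>b\<in>U. R b) \<le> M * \<delta>" by simp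
  have "\<exists>a\<in>T. (\<Sum>b\<in>U. w a b) \<le> \<kappa> * \<delta> * M"
  proof (rule ccontr)
    assume "\<not> ?thesis"
    then have "(\<Sum>a\<in>T. \<kappa> * \<delta> * M) < (\<Sum>a\<in>T. \<Sum>b\<in>U. w a b)"
      using T by (intro sum_strict_mono) auto
    then have "\<kappa> * \<delta> * M * card T < (\<Sum>b\<in>U. \<Sum>a\<in>T. w a b)"
      by (subst (asm) sum.swap) (simp add: mult.commute)
    also have "\<dots> \<le> (\<Sum>b\<in>U. \<kappa> * R b * card T)"
      using U T avg by (intro sum_mono) (auto simp: pos_divide_le_eq card_gt_0_iff)
    also have "\<dots> = \<kappa> * (\<Sum>b\<in>U. R b) * card T"
      by (simp add: sum_distrib_left sum_distrib_right)
    also have "\<dots> \<le> \<kappa> * (M * \<delta>) * card T"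
      using RU \<kappa> by (intro mult_right_mono mult_left_mono) auto
    finally show False by (simp add: mult_ac)
  qed
  then obtain a where a: "a \<in> T" "(\<Sum>b\<in>U. w a b) \<le> \<kappa> * \<delta> * M" by blast
  define \<phi>' where "\<phi>' = \<phi>(Suc M := a)"
  define D' where "D' = D(Suc M := A a - U)"
  have old: "\<phi>' i = \<phi> i" "D' i = D i" if "i \<in> {1..M}" for i
    using that by (auto simp: \<phi>'_def D'_def)
  have new: "\<phi>' (Suc M) = a" "D' (Suc M) = A a - U" by (auto simp: \<phi>'_def D'_def)
  have "\<phi>' i \<in> T \<and> D' i \<subseteq> A (\<phi>' i) \<and>
      (\<Sum>b\<in>A (\<phi>' i). w (\<phi>' i) b) - \<kappa> * \<delta> * real M \<le> (\<Sum>b\<in>D' i. w (\<phi>' i) b)"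
    if "i \<in> {1..Suc M}" for i
  proof (cases "i = Suc M")
    case True
    have "(\<Sum>b\<in>A a. w a b) = (\<Sum>b\<in>A a - U. w a b) + (\<Sum>b\<in>A a \<inter> U. w a b)"
      using finA[OF a(1)] by (metis (no_types) sum.Int_Diff add.commute)
    moreover have "(\<Sum>b\<in>A a \<inter> U. w a b) \<le> (\<Sum>b\<in>U. w a b)"
      using w U \<Omega> by (intro sum_mono2) (auto intro: finite_subset)
    ultimately show ?thesis using True new a by auto
  next
    case False
    then have i: "i \<in> {1..M}" using that by auto
    have "\<kappa> * \<delta> * real (M - 1) \<le> \<kappa> * \<delta> * real M"
      using \<kappa> \<delta> by (intro mult_left_mono) auto
    then show ?thesis using \<phi>[OF i] unfolding old[OF i] by auto
  qed
  moreover have "D' i \<inter> D' j = {}" if "i \<in> {1..Suc M}" "j \<in> {1..Suc M}" "i \<noteq> j" for i j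
  proof -
    note neq = that(3)
    have new_disj: "D k \<inter> (A a - U) = {}" if "k \<in> {1..M}" for k
      using that by (auto simp: U_def)
    have "i \<in> {1..M} \<or> i = Suc M" "j \<in> {1..M} \<or> j = Suc M"
      using that by auto
    then consider "i \<in> {1..M}" "j \<in> {1..M}" | "i = Suc M" "j \<in> {1..M}" | "i \<in> {1..M}" "j = Suc M"
      using neq by blast
    then show ?thesis
      using disj[of i j] neq new_disj by cases (auto simp: old new)
  qed
  ultimately show ?case by (intro exI[of _ \<phi>'] exI[of _ D']) auto
qed simp

subsection \<open>Achievability\<close>

text \<open>A constant \<open>B\<close> with \<open>m x / n \<le> (1 + B / n) * P x\<close> for
  every type \<open>m\<close> within \<open>CARD('x)\<close> of \<open>n * P\<close> and supported
  where \<open>P\<close> is; the factors multiply to at most \<open>exp B\<close>. Letters with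
  \<open>P x = 0\<close> contribute 0 by the convention for division.\<close>

definition dist_spread :: "('x::finite \<Rightarrow> real) \<Rightarrow> real" where
  "dist_spread P = (\<Sum>x\<in>UNIV. real CARD('x) / P x)"

text \<open>Supplies the averaging hypothesis of \<open>greedy_code\<close>. Each uniform weight is
  bounded by a multiple of the product weight under \<open>P\<close>, and extending the sum from the
  class to all words lets it factor into output probabilities.\<close>

lemma typeclass_output_le:
  fixes W :: "'x::finite \<Rightarrow> 'y::finite \<Rightarrow> real"
  assumes W: "is_channel W" and P: "is_dist P"
    and n: "(\<Sum>x\<in>UNIV. m x) = n" "0 < n"
    and near: "\<And>x. \<bar>real (m x) - n * P x\<bar> \<le> CARD('x)" and supp: "\<And>x. P x = 0 \<Longrightarrow> m x = 0"
    and ys: "length ys = n"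
  shows "(\<Sum>xs\<in>typeclass m. prodchan W xs ys) / real (card (typeclass m))
       \<le> real (n + 1) ^ CARD('x) * exp (dist_spread P) * (\<Prod>i<n. outdist P W (ys ! i))"
proof -
  define B where "B = dist_spread P"
  have B0: "0 \<le> B"
    unfolding B_def dist_spread_def by (intro sum_nonneg divide_nonneg_nonneg) (auto simp: dist_nonneg[OF P])
  have ratio: "real (m x) / n \<le> (1 + B / n) * P x" for x
  proof (cases "P x = 0")
    case False
    then have Px: "0 < P x" using dist_nonneg[OF P, of x] by simp
    have "CARD('x) / P x \<le> B"
      unfolding B_def dist_spread_def
      by (rule member_le_sum[of x UNIV "\<lambda>x. CARD('x) / P x"])
        (auto simp: dist_nonneg[OF P] intro!: divide_nonneg_nonneg)
    then have "CARD('x) \<le> B * P x" using Px by (simp add: pos_divide_le_eq)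
    then have "real (m x) \<le> n * P x + B * P x" using near[of x] by linarith
    then have "real (m x) / n \<le> (n * P x + B * P x) / n"
      by (intro divide_right_mono) auto
    then show ?thesis using n(2) by (simp add: field_simps)
  qed (simp add: supp)
  have "(1 + B / n) ^ n \<le> exp B"
    using B0 n(2) by (intro exp_ge_one_plus_x_over_n_power_n) auto
  have unif: "1 / real (card (typeclass m)) \<le> real (n + 1) ^ CARD('x) * exp B * (\<Prod>i<n. P (xs ! i))"
    if "xs \<in> typeclass m" for xs
  proof -
    have "1 / real (card (typeclass m)) \<le> real (n + 1) ^ CARD('x) * (\<Prod>i<n. real (m (xs ! i)) / real n)"
      by (rule uniform_typeclass_le[OF n(1)[symmetric] n(2) that])
    also have "\<dots> \<le> real (n + 1) ^ CARD('x) * (\<Prod>i<n. (1 + B / n) * P (xs ! i))"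
      using ratio by (intro mult_left_mono prod_mono) auto
    also have "(\<Prod>i<n. (1 + B / n) * P (xs ! i)) = (1 + B / n) ^ n * (\<Prod>i<n. P (xs ! i))"
      by (simp add: prod.distrib)
    also have "\<dots> \<le> exp B * (\<Prod>i<n. P (xs ! i))"
      using \<open>(1 + B / n) ^ n \<le> exp B\<close> by (intro mult_right_mono prod_nonneg) (auto simp: dist_nonneg[OF P])
    finally show ?thesis by (simp add: mult.assoc mult_left_mono)
  qed
  have "(\<Sum>xs\<in>typeclass m. prodchan W xs ys) / real (card (typeclass m))
      = (\<Sum>xs\<in>typeclass m. 1 / real (card (typeclass m)) * prodchan W xs ys)"
    by (simp add: sum_divide_distrib)
  also have "\<dots> \<le> (\<Sum>xs\<in>typeclass m. real (n + 1) ^ CARD('x) * exp B * (\<Prod>i<n. P (xs ! i)) * prodchan W xs ys)"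
    by (intro sum_mono mult_right_mono unif prodchan_nonneg[OF W])
  also have "\<dots> \<le> (\<Sum>xs | length xs = n. real (n + 1) ^ CARD('x) * exp B * (\<Prod>i<n. P (xs ! i)) * prodchan W xs ys)"
  proof (rule sum_mono2)
    show "typeclass m \<subseteq> {xs. length xs = n}"
      using length_typeclass n(1) by blast
  qed (simp_all add: mult_nonneg_nonneg prod_nonneg prodchan_nonneg[OF W] dist_nonneg[OF P])
  also have "\<dots> = (\<Sum>xs | length xs = n. real (n + 1) ^ CARD('x) * exp B * (\<Prod>i<n. P (xs ! i) * W (xs ! i) (ys ! i)))"
    by (intro sum.cong) (auto simp: prodchan_def prod.distrib)
  also have "\<dots> = real (n + 1) ^ CARD('x) * exp B * (\<Prod>i<n. outdist P W (ys ! i))"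
    using sum_words_prod[where xs = ys and g = "\<lambda>y x. P x * W x y"] ys
    by (simp add: outdist_def sum_distrib_left[symmetric])
  finally show ?thesis by (simp add: B_def)
qed

text \<open>The log-size \<rho> and the test threshold \<gamma> stay free, to be tuned later, and
  the error is expressed through one word of nearly the type \<open>P\<close>, to which the central
  limit theorem applies.\<close>

lemma constant_composition_code:
  fixes W :: "'x::finite \<Rightarrow> 'y::finite \<Rightarrow> real"
  assumes W: "is_channel W" and P: "is_dist P" "expcost P c \<le> K" and n: "0 < n"
  shows "\<exists>\<Phi> xs. is_code n \<Phi> \<and> code_supp \<Phi> \<subseteq> cost_constrained c K n \<and> exp \<rho> \<le> real (code_size \<Phi>)
      \<and> length xs = n \<and> (\<forall>x. \<bar>real (count_list xs x) - n * P x\<bar> \<le> CARD('x))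
      \<and> err_prob W \<Phi> \<le> chan_prob W xs {ys. length ys = n \<and> additive (infodens W (outdist P W)) xs ys \<le> \<gamma>}
          + real (n + 1) ^ CARD('x) * exp (dist_spread P) * exp (\<rho> - \<gamma>)"
proof -
  obtain m :: "'x \<Rightarrow> nat" where m: "(\<Sum>x\<in>UNIV. m x) = n" "(\<Sum>x\<in>UNIV. m x * c x) \<le> n * expcost P c"
      and near: "\<And>x. \<bar>real (m x) - n * P x\<bar> \<le> CARD('x)" and supp: "\<And>x. P x = 0 \<Longrightarrow> m x = 0"
    using round_to_type[where n = n and c = c, OF P(1)] by blast
  define q where "q = outdist P W"
  define T where "T = typeclass m"
  define R where "R ys = (\<Prod>i<n. q (ys ! i))" for ys
  define A where "A xs = {ys. length ys = n \<and> \<not> prodchan W xs ys \<le> exp \<gamma> * R ys}" for xs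
  define \<kappa> where "\<kappa> = real (n + 1) ^ CARD('x) * exp (dist_spread P)"
  \<comment> \<open>Rounding up guarantees the size, and the greedy loss involves only
    \<open>M - 1 \<le> exp \<rho>\<close>.\<close>
  define M where "M = nat \<lceil>exp \<rho>\<rceil>"
  have M: "exp \<rho> \<le> real M" "1 \<le> M" "real (M - 1) \<le> exp \<rho>"
    unfolding M_def by (auto simp: Suc_le_eq of_nat_diff)
  have R0: "0 \<le> R ys" for ys
    unfolding R_def q_def by (intro prod_nonneg) (simp add: outdist_nonneg[OF W P(1)])
  have lenT: "length xs = n" if "xs \<in> T" for xs
    using length_typeclass[of xs m] that m(1) by (simp add: T_def)
  have costT: "xs \<in> cost_constrained c K n" if "xs \<in> T" for xs
  proof -
    have "(\<Sum>i<n. c (xs ! i)) = (\<Sum>x\<in>UNIV. m x * c x)"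
      using sum_nth_eq_sum_count[of c xs] that lenT[OF that] by (simp add: T_def typeclass_def)
    also have "\<dots> \<le> n * K"
      using m(2) mult_left_mono[OF P(2), of "real n"] by simp
    finally show ?thesis using lenT[OF that] by (simp add: cost_constrained_def)
  qed
  have posT: "0 < q y" if "xs \<in> T" "x \<in> set xs" "0 < W x y" for xs x y
  proof -
    have "m x \<noteq> 0" using that(1,2) count_list_0_iff[of xs x] by (auto simp: T_def typeclass_def)
    then have "0 < P x" using supp[of x] dist_nonneg[OF P(1), of x] by (cases "P x = 0") auto
    then show ?thesis unfolding q_def using that(3) by (rule outdist_pos[OF W P(1)])
  qed
  have finA: "finite (A xs)" for xs
    unfolding A_def by (rule finite_subset[OF _ finite_words[of n]]) auto
  have "\<exists>\<phi> D. (\<forall>i\<in>{1..M}. \<phi> i \<in> T \<and> D i \<subseteq> A (\<phi> i) \<and>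
              (\<Sum>b\<in>A (\<phi> i). prodchan W (\<phi> i) b) - \<kappa> * exp (- \<gamma>) * real (M - 1) \<le> (\<Sum>b\<in>D i. prodchan W (\<phi> i) b))
            \<and> (\<forall>i\<in>{1..M}. \<forall>j\<in>{1..M}. i \<noteq> j \<longrightarrow> D i \<inter> D j = {})"
  proof (rule greedy_code[where R = R])
    show "finite T" "T \<noteq> {}"
      by (auto simp: T_def finite_typeclass typeclass_nonempty)
    show "finite {ys :: 'y list. length ys = n}" by simp
    show "A xs \<subseteq> {ys. length ys = n}" for xs by (auto simp: A_def)
    \<comment> \<open>Change of measure: on \<open>A xs\<close> the reference is below
      \<open>exp (- \<gamma>)\<close> times the channel probability.\<close>
    show "(\<Sum>ys\<in>A xs. R ys) \<le> exp (- \<gamma>)" if "xs \<in> T" for xs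
    proof -
      have "(\<Sum>ys\<in>A xs. R ys) \<le> (\<Sum>ys\<in>A xs. exp (- \<gamma>) * prodchan W xs ys)"
        by (intro sum_mono) (auto simp: A_def exp_minus field_simps)
      also have "\<dots> = exp (- \<gamma>) * chan_prob W xs (A xs)"
        by (simp add: chan_prob_def sum_distrib_left)
      also have "\<dots> \<le> exp (- \<gamma>) * 1"
        using lenT[OF that] by (intro mult_left_mono chan_prob_le_1[OF W]) (auto simp: A_def)
      finally show ?thesis by simp
    qed
    show "(\<Sum>xs\<in>T. prodchan W xs ys) / real (card T) \<le> \<kappa> * R ys" if "ys \<in> {ys. length ys = n}" for ys
      unfolding T_def \<kappa>_def R_def q_def
      using that by (intro typeclass_output_le[OF W P(1) m(1) n near supp]) auto
    show "0 \<le> \<kappa>" by (simp add: \<kappa>_def)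
  qed (auto simp: prodchan_nonneg[OF W] R0)
  then obtain \<phi> D where
    *: "\<forall>i\<in>{1..M}. \<phi> i \<in> T \<and> D i \<subseteq> A (\<phi> i) \<and>
          (\<Sum>b\<in>A (\<phi> i). prodchan W (\<phi> i) b) - \<kappa> * exp (- \<gamma>) * real (M - 1) \<le> (\<Sum>b\<in>D i. prodchan W (\<phi> i) b)"
    and disj: "\<forall>i\<in>{1..M}. \<forall>j\<in>{1..M}. i \<noteq> j \<longrightarrow> D i \<inter> D j = {}"
    by (elim exE conjE)
  have \<phi>: "\<phi> i \<in> T" "D i \<subseteq> A (\<phi> i)"
      "chan_prob W (\<phi> i) (A (\<phi> i)) - \<kappa> * exp (- \<gamma>) * real (M - 1) \<le> chan_prob W (\<phi> i) (D i)"
    if "i \<in> {1..M}" for i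
    using *[rule_format, OF that] by (simp_all add: chan_prob_def)
  define F where "F xs = chan_prob W xs {ys. length ys = n \<and> additive (infodens W q) xs ys \<le> \<gamma>}" for xs
  have FA: "1 - chan_prob W xs (A xs) = F xs" if "xs \<in> T" for xs
    using chan_prob_compl[OF W, of xs "\<lambda>ys. prodchan W xs ys \<le> exp \<gamma> * R ys"]
      chan_prob_likelihood_ratio[where xs = xs and q = q and \<gamma> = \<gamma>, OF W posT[OF that]] lenT[OF that]
    by (simp add: A_def F_def R_def)
  have "T \<noteq> {}" "finite T" by (auto simp: T_def finite_typeclass typeclass_nonempty)
  \<comment> \<open>By symmetry \<open>F\<close> is constant on the class, but taking a maximiser of
    the finite set bounds every message without a permutation argument.\<close>
  then obtain xs where xs: "xs \<in> T" "\<And>zs. zs \<in> T \<Longrightarrow> F zs \<le> F xs"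
    using ex_is_arg_min_if_finite[of T "\<lambda>xs. - F xs"] by (auto simp: is_arg_min_linorder)
  have "exp (- \<gamma>) * real (M - 1) \<le> exp (\<rho> - \<gamma>)"
    using mult_left_mono[OF M(3), of "exp (- \<gamma>)"] by (simp add: exp_diff exp_minus field_simps)
  then have "\<kappa> * (exp (- \<gamma>) * real (M - 1)) \<le> \<kappa> * exp (\<rho> - \<gamma>)"
    by (intro mult_left_mono) (auto simp: \<kappa>_def)
  then have each: "1 - chan_prob W (\<phi> i) (D i) \<le> F xs + \<kappa> * exp (\<rho> - \<gamma>)" if "i \<in> {1..M}" for i
    using \<phi>(3)[OF that] FA[OF \<phi>(1)[OF that]] xs(2)[OF \<phi>(1)[OF that]] by (simp add: mult.assoc)
  have "(\<Sum>i=1..M. 1 - chan_prob W (\<phi> i) (D i)) \<le> (\<Sum>i=1..M. F xs + \<kappa> * exp (\<rho> - \<gamma>))"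
    by (intro sum_mono each)
  then have err: "err_prob W (M, \<phi>, D) \<le> F xs + \<kappa> * exp (\<rho> - \<gamma>)"
    using M(2) by (simp add: err_prob_def field_simps)
  have "is_code n (M, \<phi>, D)"
    unfolding is_code_def prod.case
  proof (intro conjI ballI)
    fix i assume "i \<in> {1..M}"
    from \<phi>(1,2)[OF this] show "length (\<phi> i) = n" "D i \<subseteq> {ys. length ys = n}"
      by (auto simp: lenT A_def)
  qed (use M(2) disj in auto)
  moreover have "code_supp (M, \<phi>, D) \<subseteq> cost_constrained c K n"
    using \<phi>(1) costT by (auto simp: code_supp_def)
  moreover have "\<forall>x. \<bar>real (count_list xs x) - n * P x\<bar> \<le> CARD('x)"
    using near xs(1) by (simp add: T_def typeclass_def)
  ultimately show ?thesis
    using err M(1) lenT[OF xs(1)]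
    by (intro exI[of _ "(M, \<phi>, D)"] exI[of _ xs]) (simp add: code_size_def F_def q_def \<kappa>_def)
qed

theorem achievability:
  fixes W :: "'x::finite \<Rightarrow> 'y::finite \<Rightarrow> real"
  assumes W: "is_channel W" and P: "P \<in> cap_achievers W c K" and V: "0 < dispersion P W"
  shows "\<exists>\<Phi>. admissible_codes c K \<Phi> \<and> ereal a \<le> liminf (\<lambda>n. ereal (second_order W c K \<Phi> n))
           \<and> limsup (\<lambda>n. ereal (err_prob W (\<Phi> n))) \<le> ereal (Gauss (a / sqrt (dispersion P W)))"
proof -
  let ?C = "capacity W c K"
  define q where "q = outdist P W"
  have Pd: "is_dist P" "expcost P c \<le> K" and PC: "mutinf P W = ?C"
    using P by (auto simp: cap_achievers_def)
  define \<rho> where "\<rho> n = n * ?C + a * sqrt n" for n :: nat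
  \<comment> \<open>Any exponent strictly between 0 and 1/2 would do:
    \<open>exp (- (n powr (1/4)))\<close> beats the polynomial \<open>\<kappa> n\<close>, while the
    shift of the threshold vanishes relative to \<open>sqrt n\<close>.\<close>
  define \<gamma> where "\<gamma> n = \<rho> n + n powr (1/4)" for n :: nat
  define \<kappa> where "\<kappa> n = real (n + 1) ^ CARD('x) * exp (dist_spread P)" for n :: nat
  define good where "good n \<Phi> xs \<longleftrightarrow> is_code n \<Phi> \<and> code_supp \<Phi> \<subseteq> cost_constrained c K n
      \<and> exp (\<rho> n) \<le> real (code_size \<Phi>)
      \<and> length xs = n \<and> (\<forall>x. \<bar>real (count_list xs x) - n * P x\<bar> \<le> CARD('x))
      \<and> err_prob W \<Phi> \<le> chan_prob W xs {ys. length ys = n \<and> additive (infodens W q) xs ys \<le> \<gamma> n}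
          + \<kappa> n * exp (\<rho> n - \<gamma> n)" for n and \<Phi> :: "('x, 'y) code" and xs
  have "\<exists>p. good n (fst p) (snd p)" if "0 < n" for n
    using constant_composition_code[OF W Pd that, of "\<rho> n" "\<gamma> n"] by (auto simp: good_def q_def \<kappa>_def)
  then obtain p where p: "\<And>n. 0 < n \<Longrightarrow> good n (fst (p n)) (snd (p n))" by metis
  \<comment> \<open>Admissibility also demands a code of length 0: one empty codeword, whose cost
    bound is \<open>0 \<le> 0\<close> and whose error does not affect the limits.\<close>
  define \<Phi> where "\<Phi> n = (if n = 0 then (1, \<lambda>_. [], \<lambda>_. {}) else fst (p n))" for n
  define xs where "xs n = (if n = 0 then [] else snd (p n))" for n
  have good: "good n (\<Phi> n) (xs n)" if "0 < n" for n
    using p[OF that] that by (simp add: \<Phi>_def xs_def)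
  have len: "length (xs n) = n" for n
    using good[of n] by (cases "n = 0") (auto simp: xs_def good_def)
  have adm: "admissible_codes c K \<Phi>"
    unfolding admissible_codes_def
  proof
    fix n show "is_code n (\<Phi> n) \<and> code_supp (\<Phi> n) \<subseteq> cost_constrained c K n"
      using good[of n] by (cases "n = 0")
        (auto simp: \<Phi>_def is_code_def code_supp_def cost_constrained_def good_def)
  qed
  have so: "a \<le> second_order W c K \<Phi> n" if "0 < n" for n
  proof -
    have e: "exp (\<rho> n) \<le> real (code_size (\<Phi> n))" using good[OF that] by (simp add: good_def)
    then have "0 < real (code_size (\<Phi> n))" by (smt (verit) exp_gt_zero)
    with e have "\<rho> n \<le> ln (real (code_size (\<Phi> n)))" by (simp add: ln_ge_iff)
    then show ?thesis using that by (simp add: second_order_def \<rho>_def field_simps)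
  qed
  have "ereal a \<le> liminf (\<lambda>n. ereal (second_order W c K \<Phi> n))"
    by (intro Liminf_bounded eventually_mono[OF eventually_gt_at_top[of 0]]) (use so in auto)
  moreover have "limsup (\<lambda>n. ereal (err_prob W (\<Phi> n))) \<le> ereal (Gauss (a / sqrt (dispersion P W)))"
  proof -
    define \<mu> where "\<mu> n = (\<Sum>x\<in>UNIV. empdist (xs n) x * relent (W x) q)" for n
    define u where "u n = (\<gamma> n - n * \<mu> n) / sqrt n" for n
    define E where "E f = real CARD('x) * (\<Sum>x\<in>UNIV. \<bar>f x\<bar>)" for f :: "'x \<Rightarrow> real"
    \<comment> \<open>The rate \<open>1 / n\<close> is essential: it keeps
      \<open>n * (?C - \<mu> n)\<close> bounded, so that \<open>u n\<close> tends to
      \<open>a\<close>; mere convergence of the types would not.\<close>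
    have emp: "\<bar>(\<Sum>x\<in>UNIV. empdist (xs n) x * f x) - (\<Sum>x\<in>UNIV. P x * f x)\<bar> \<le> E f / n" if "0 < n" for n f
    proof -
      have "\<bar>empdist (xs n) x - P x\<bar> \<le> CARD('x) / n" for x
      proof -
        have "\<bar>empdist (xs n) x - P x\<bar> = \<bar>real (count_list (xs n) x) - n * P x\<bar> / n"
        proof -
          have "empdist (xs n) x - P x = (real (count_list (xs n) x) - n * P x) / n"
            using that by (simp add: empdist_def len diff_divide_distrib)
          then show ?thesis by simp
        qed
        also have "\<dots> \<le> CARD('x) / n"
          using good[OF that] by (intro divide_right_mono) (auto simp: good_def)
        finally show ?thesis .
      qed
      then have "\<bar>\<Sum>x\<in>UNIV. (empdist (xs n) x - P x) * f x\<bar> \<le> (\<Sum>x\<in>UNIV. CARD('x) / n * \<bar>f x\<bar>)"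
        by (intro order_trans[OF sum_abs] sum_mono) (simp only: abs_mult mult_right_mono abs_ge_zero)
      then show ?thesis
        by (simp add: E_def left_diff_distrib sum_subtractf sum_distrib_left[symmetric] sum_divide_distrib[symmetric])
    qed
    have emp_lim: "(\<lambda>n. \<Sum>x\<in>UNIV. empdist (xs n) x * f x) \<longlonglongrightarrow> (\<Sum>x\<in>UNIV. P x * f x)" for f
    proof (rule Lim_transform2)
      show "(\<lambda>n. \<Sum>x\<in>UNIV. P x * f x) \<longlonglongrightarrow> (\<Sum>x\<in>UNIV. P x * f x)" by simp
      show "(\<lambda>n. (\<Sum>x\<in>UNIV. P x * f x) - (\<Sum>x\<in>UNIV. empdist (xs n) x * f x)) \<longlonglongrightarrow> 0"
      proof (rule Lim_null_comparison)
        show "(\<lambda>n. E f / real n) \<longlonglongrightarrow> 0" by (rule lim_const_over_n)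
        show "\<forall>\<^sub>F n in sequentially. norm ((\<Sum>x\<in>UNIV. P x * f x) - (\<Sum>x\<in>UNIV. empdist (xs n) x * f x)) \<le> E f / real n"
          using eventually_gt_at_top[of 0] by eventually_elim (use emp in \<open>simp add: abs_minus_commute\<close>)
      qed
    qed
    have C: "(\<Sum>x\<in>UNIV. P x * relent (W x) q) = ?C"
      using PC by (simp add: mutinf_def q_def)
    have u_lim: "u \<longlonglongrightarrow> a"
    proof (rule Lim_transform2)
      show "(\<lambda>n :: nat. a) \<longlonglongrightarrow> a" by simp
      let ?e = "E (\<lambda>x. relent (W x) q)"
      show "(\<lambda>n. a - u n) \<longlonglongrightarrow> 0"
      proof (rule Lim_null_comparison)
        have "(\<lambda>n. real n powr (1/4) / sqrt (real n) + e / sqrt (real n)) \<longlonglongrightarrow> 0" for e :: real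
          by real_asymp
        then show "(\<lambda>n. real n powr (1/4) / sqrt (real n) + ?e / sqrt (real n)) \<longlonglongrightarrow> 0" .
        show "\<forall>\<^sub>F n in sequentially. norm (a - u n) \<le> real n powr (1/4) / sqrt (real n) + ?e / sqrt (real n)"
          using eventually_gt_at_top[of 0]
        proof eventually_elim
          case (elim n)
          have "u n - a = n powr (1/4) / sqrt n + n * (?C - \<mu> n) / sqrt n"
            using elim by (simp add: u_def \<gamma>_def \<rho>_def field_simps)
          moreover have "\<bar>n * (?C - \<mu> n) / sqrt n\<bar> \<le> ?e / sqrt n"
          proof -
            have "\<bar>?C - \<mu> n\<bar> \<le> ?e / n"
              using emp[OF elim, of "\<lambda>x. relent (W x) q"] C by (simp add: \<mu>_def abs_minus_commute)
            then have "n * \<bar>?C - \<mu> n\<bar> \<le> ?e" using elim by (simp add: field_simps)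
            then show ?thesis by (simp add: abs_mult divide_right_mono)
          qed
          moreover have "0 \<le> n powr (1/4) / sqrt n" by simp
          moreover have "\<bar>d\<bar> \<le> y + e" if "d = y + z" "\<bar>z\<bar> \<le> e" "0 \<le> y" for d y z e :: real
            using that by linarith
          ultimately have "\<bar>u n - a\<bar> \<le> n powr (1/4) / sqrt n + ?e / sqrt n"
            by blast
          then show ?case by (simp add: abs_minus_commute)
        qed
      qed
    qed
    have clt: "(\<lambda>n. chan_prob W (xs n) {ys. length ys = length (xs n) \<and>
          additive (centered W q) (xs n) ys \<le> u n * sqrt (length (xs n))})
        \<longlonglongrightarrow> Gauss (a / sqrt (dispersion P W))"
    proof (rule channel_clt[OF W centered_mean[OF W] _ _ V u_lim])
      show "filterlim (\<lambda>n. length (xs n)) at_top sequentially"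
        by (simp add: len filterlim_ident)
      show "(\<lambda>n. (\<Sum>i<length (xs n). \<Sum>y\<in>UNIV. W (xs n ! i) y * (centered W q (xs n ! i) y)\<^sup>2)
            / real (length (xs n))) \<longlonglongrightarrow> dispersion P W"
      proof (rule Lim_transform_eventually)
        show "(\<lambda>n. \<Sum>x\<in>UNIV. empdist (xs n) x * infovar W q x) \<longlonglongrightarrow> dispersion P W"
          unfolding dispersion_eq q_def[symmetric] by (rule emp_lim)
        show "\<forall>\<^sub>F n in sequentially. (\<Sum>x\<in>UNIV. empdist (xs n) x * infovar W q x)
            = (\<Sum>i<length (xs n). \<Sum>y\<in>UNIV. W (xs n ! i) y * (centered W q (xs n ! i) y)\<^sup>2) / real (length (xs n))"
          using eventually_gt_at_top[of 0]
          by eventually_elim (simp add: len infovar_centered[symmetric] sum_nth_eq_empdist[of "infovar W q" "xs _", unfolded len])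
      qed
    qed
    have "(\<lambda>n. real (n + 1) ^ d * e * exp (- (real n powr (1/4)))) \<longlonglongrightarrow> 0" for d :: nat and e :: real
      by real_asymp
    then have "(\<lambda>n. \<kappa> n * exp (- (real n powr (1/4)))) \<longlonglongrightarrow> 0"
      unfolding \<kappa>_def .
    then have rhs: "(\<lambda>n. chan_prob W (xs n) {ys. length ys = length (xs n) \<and>
          additive (centered W q) (xs n) ys \<le> u n * sqrt (length (xs n))} + \<kappa> n * exp (- (real n powr (1/4))))
        \<longlonglongrightarrow> Gauss (a / sqrt (dispersion P W)) + 0"
      by (rule tendsto_add[OF clt])
    have "\<forall>\<^sub>F n in sequentially. ereal (err_prob W (\<Phi> n)) \<le> ereal (chan_prob W (xs n) {ys. length ys = length (xs n) \<and>
          additive (centered W q) (xs n) ys \<le> u n * sqrt (length (xs n))} + \<kappa> n * exp (- (real n powr (1/4))))"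
      using eventually_gt_at_top[of 0]
    proof eventually_elim
      case (elim n)
      have "{ys. length ys = n \<and> additive (infodens W q) (xs n) ys \<le> \<gamma> n}
          = {ys. length ys = length (xs n) \<and> additive (centered W q) (xs n) ys \<le> u n * sqrt (length (xs n))}"
        using elim by (auto simp: additive_infodens len u_def \<mu>_def[symmetric])
      then show ?case
        using good[OF elim] by (simp add: good_def \<gamma>_def len)
    qed
    then have "limsup (\<lambda>n. ereal (err_prob W (\<Phi> n))) \<le> limsup (\<lambda>n. ereal (chan_prob W (xs n) {ys. length ys = length (xs n) \<and>
          additive (centered W q) (xs n) ys \<le> u n * sqrt (length (xs n))} + \<kappa> n * exp (- (real n powr (1/4)))))"
      by (rule Limsup_mono)
    also have "\<dots> = ereal (Gauss (a / sqrt (dispersion P W)))"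
      using rhs by (intro lim_imp_Limsup) auto
    finally show ?thesis .
  qed
  ultimately show ?thesis using adm by blast
qed

subsection \<open>The second-order coding theorem\<close>

lemma limit_error_eq:
  assumes "0 < Vminus W c K" "Vminus W c K \<le> Vplus W c K"
  shows "limit_error W c K a
    = (if 0 \<le> a then Gauss (a / sqrt (Vplus W c K)) else Gauss (a / sqrt (Vminus W c K)))"
proof (cases "0 \<le> a")
  case True
  then have "a / sqrt (Vplus W c K) \<le> a / sqrt (Vminus W c K)"
    using assms by (intro divide_left_mono) auto
  then show ?thesis using True by (simp add: limit_error_def min_def)
next
  case False
  then have "a / sqrt (Vminus W c K) \<le> a / sqrt (Vplus W c K)"
    using assms by (intro divide_left_mono_neg) auto
  then show ?thesis using False by (simp add: limit_error_def min_def)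
qed

lemma limit_error_strict_mono:
  assumes "0 < Vminus W c K" "Vminus W c K \<le> Vplus W c K"
  shows "strict_mono (limit_error W c K)"
proof (rule strict_monoI)
  fix a b :: real assume "a < b"
  then have "a / sqrt (Vplus W c K) < b / sqrt (Vplus W c K)" "a / sqrt (Vminus W c K) < b / sqrt (Vminus W c K)"
    using assms by (auto intro!: divide_strict_right_mono)
  then show "limit_error W c K a < limit_error W c K b"
    unfolding limit_error_def strict_mono_less[OF Gauss_strict_mono] by auto
qed

text \<open>Approaching the extreme dispersions is enough, because the bounds from achievability
  depend continuously on the dispersion and pass to the limit.\<close>

lemma extreme_dispersion_sequence:
  assumes W: "is_channel W" and ex: "\<exists>P. is_dist P \<and> expcost P c \<le> K" and V: "V \<in> {Vplus W c K, Vminus W c K}"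
  shows "\<exists>P. (\<forall>k::nat. P k \<in> cap_achievers W c K) \<and> (\<lambda>k. dispersion (P k) W) \<longlonglongrightarrow> V"
proof -
  let ?S = "(\<lambda>P. dispersion P W) ` cap_achievers W c K"
  have ne: "?S \<noteq> {}" using capacity_attained(1)[OF W ex] by simp
  have "V \<in> closure ?S"
    using V closure_contains_Sup[OF ne bdd_dispersion(1)[OF W ex]] closure_contains_Inf[OF ne bdd_dispersion(2)[OF W ex]]
    by (auto simp: Vplus_def Vminus_def)
  then obtain v where v: "\<And>k. v k \<in> ?S" "v \<longlonglongrightarrow> V"
    unfolding closure_sequential by blast
  have "\<exists>P. P \<in> cap_achievers W c K \<and> v k = dispersion P W" for k
    using v(1)[of k] by auto
  then obtain P where P: "\<And>k. P k \<in> cap_achievers W c K" "\<And>k. v k = dispersion (P k) W"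
    by metis
  have "v = (\<lambda>k. dispersion (P k) W)" using P(2) by auto
  with v(2) P(1) show ?thesis by auto
qed

lemma Vminus_le_Vplus:
  assumes "is_channel W" "\<exists>P. is_dist P \<and> expcost P c \<le> K"
  shows "Vminus W c K \<le> Vplus W c K"
  using capacity_attained(1)[OF assms] dispersion_bounds[OF assms] by (meson ex_in_conv order_trans)

lemma Cp_DM_eq:
  assumes W: "is_channel W" and ex: "\<exists>P. is_dist P \<and> expcost P c \<le> K" and pos: "0 < Vminus W c K"
  shows "Cp_DM W c K a = ereal (limit_error W c K a)"
proof (rule antisym)
  note V_le = Vminus_le_Vplus[OF W ex]
  define V where "V = (if 0 \<le> a then Vplus W c K else Vminus W c K)"
  have "V \<in> {Vplus W c K, Vminus W c K}" by (simp add: V_def)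
  then obtain P where P: "\<And>k::nat. P k \<in> cap_achievers W c K" "(\<lambda>k. dispersion (P k) W) \<longlonglongrightarrow> V"
    using extreme_dispersion_sequence[OF W ex] by blast
  have V0: "0 < V" using pos V_le by (auto simp: V_def)
  have le: "Cp_DM W c K a \<le> ereal (Gauss (a / sqrt (dispersion (P k) W)))" for k
  proof -
    have "0 < dispersion (P k) W" using dispersion_bounds(1)[OF W ex P(1)[of k]] pos by simp
    from achievability[OF W P(1) this, of a] show ?thesis
      unfolding Cp_DM_def by (auto intro: Inf_lower2)
  qed
  have "(\<lambda>k. Gauss (a / sqrt (dispersion (P k) W))) \<longlonglongrightarrow> Gauss (a / sqrt V)"
    using V0 by (intro isCont_tendsto_compose[OF isCont_Gauss] tendsto_intros P(2)) simp
  then have "(\<lambda>k. ereal (Gauss (a / sqrt (dispersion (P k) W)))) \<longlonglongrightarrow> ereal (Gauss (a / sqrt V))"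
    by simp
  then have "Cp_DM W c K a \<le> ereal (Gauss (a / sqrt V))"
    by (rule LIMSEQ_le_const) (use le in blast)
  then show "Cp_DM W c K a \<le> ereal (limit_error W c K a)"
    by (simp add: limit_error_eq[OF pos V_le] V_def split: if_splits)
  show "ereal (limit_error W c K a) \<le> Cp_DM W c K a"
    unfolding Cp_DM_def by (intro Inf_greatest) (auto intro: converse[OF W ex pos])
qed

text \<open>Writing \<epsilon> as \<open>Gauss g\<close> turns the case split at 1/2 into the sign
  of \<open>g\<close>. A rate above \<open>sqrt V * g\<close> would, by the converse and strict
  monotonicity, force an error above \<open>Gauss g\<close>.\<close>

lemma C_DM_eq:
  assumes W: "is_channel W" and ex: "\<exists>P. is_dist P \<and> expcost P c \<le> K" and pos: "0 < Vminus W c K"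
    and V: "V = (if 0 \<le> g then Vplus W c K else Vminus W c K)"
  shows "C_DM W c K (Gauss g) = ereal (sqrt V * g)"
proof (rule antisym)
  note V_le = Vminus_le_Vplus[OF W ex]
  have V0: "0 < V" using pos V_le by (auto simp: V)
  have sgn: "0 \<le> sqrt V * g \<longleftrightarrow> 0 \<le> g" using V0 by (simp add: zero_le_mult_iff)
  have b: "limit_error W c K (sqrt V * g) = Gauss g"
  proof -
    have "limit_error W c K (sqrt V * g) = Gauss (sqrt V * g / sqrt V)"
      unfolding limit_error_eq[OF pos V_le] sgn by (simp add: V)
    then show ?thesis using V0 by simp
  qed
  show "C_DM W c K (Gauss g) \<le> ereal (sqrt V * g)"
    unfolding C_DM_def
  proof (rule Sup_least, clarify)
    fix \<Phi> :: "nat \<Rightarrow> ('a, 'b) code"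
    assume adm: "admissible_codes c K \<Phi>"
      and err: "limsup (\<lambda>n. ereal (err_prob W (\<Phi> n))) \<le> ereal (Gauss g)"
    show "liminf (\<lambda>n. ereal (second_order W c K \<Phi> n)) \<le> ereal (sqrt V * g)"
    proof (rule ccontr)
      assume "\<not> ?thesis"
      then obtain a where a: "ereal (sqrt V * g) < ereal a"
          "ereal a < liminf (\<lambda>n. ereal (second_order W c K \<Phi> n))"
        using ereal_dense2 by (metis not_le)
      have "ereal (limit_error W c K a) \<le> ereal (Gauss g)"
        using converse[OF W ex pos adm, of a] a(2) err by (meson less_imp_le order_trans)
      then show False
        using strict_monoD[OF limit_error_strict_mono[OF pos V_le], of "sqrt V * g" a] a(1) b by simp
    qed
  qed
  have "V \<in> {Vplus W c K, Vminus W c K}" by (simp add: V)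
  then obtain P where P: "\<And>k::nat. P k \<in> cap_achievers W c K" "(\<lambda>k. dispersion (P k) W) \<longlonglongrightarrow> V"
    using extreme_dispersion_sequence[OF W ex] by blast
  \<comment> \<open>At rate \<open>sqrt (dispersion (P k) W) * g\<close> the error bound is
    \<open>Gauss g\<close> for every \<open>k\<close>, so only the rate has to pass to the
    limit.\<close>
  have le: "ereal (sqrt (dispersion (P k) W) * g) \<le> C_DM W c K (Gauss g)" for k
  proof -
    have d: "0 < dispersion (P k) W" using dispersion_bounds(1)[OF W ex P(1)[of k]] pos by simp
    have g: "sqrt (dispersion (P k) W) * g / sqrt (dispersion (P k) W) = g" using d by simp
    from achievability[OF W P(1) d, of "sqrt (dispersion (P k) W) * g"] show ?thesis
      unfolding C_DM_def g by (auto intro: Sup_upper2)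
  qed
  have "(\<lambda>k. ereal (sqrt (dispersion (P k) W) * g)) \<longlonglongrightarrow> ereal (sqrt V * g)"
    unfolding lim_ereal by (intro tendsto_intros P(2))
  then show "ereal (sqrt V * g) \<le> C_DM W c K (Gauss g)"
    by (rule LIMSEQ_le_const2) (use le in blast)
qed

theorem mainTheorem2:
  fixes W :: "'x::finite \<Rightarrow> 'y::finite \<Rightarrow> real"
    and c :: "'x \<Rightarrow> real" and K :: real
  assumes "is_channel W"
    and "\<exists>P. is_dist P \<and> expcost P c \<le> K"
    and "Vminus W c K > 0"
  shows "(\<forall>a::real. Cp_DM W c K a =
            (if a \<ge> 0 then ereal (Gauss (a / sqrt (Vplus W c K)))
             else ereal (Gauss (a / sqrt (Vminus W c K)))))
       \<and> (\<forall>\<epsilon>::real. 0 < \<epsilon> \<and> \<epsilon> < 1 \<longrightarrow> C_DM W c K \<epsilon> =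
            (if \<epsilon> \<ge> 1/2 then ereal (sqrt (Vplus W c K) * Gauss_inv \<epsilon>)
             else ereal (sqrt (Vminus W c K) * Gauss_inv \<epsilon>)))"
proof (intro conjI allI impI)
  note V_le = Vminus_le_Vplus[OF assms(1,2)]
  fix a :: real
  show "Cp_DM W c K a = (if a \<ge> 0 then ereal (Gauss (a / sqrt (Vplus W c K)))
             else ereal (Gauss (a / sqrt (Vminus W c K))))"
    using Cp_DM_eq[OF assms] limit_error_eq[OF assms(3) V_le] by simp
next
  fix \<epsilon> :: real assume \<epsilon>: "0 < \<epsilon> \<and> \<epsilon> < 1"
  show "C_DM W c K \<epsilon> = (if \<epsilon> \<ge> 1/2 then ereal (sqrt (Vplus W c K) * Gauss_inv \<epsilon>)
             else ereal (sqrt (Vminus W c K) * Gauss_inv \<epsilon>))"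
    using C_DM_eq[OF assms refl, of "Gauss_inv \<epsilon>"] Gauss_inv[of \<epsilon>] Gauss_inv_nonneg_iff[of \<epsilon>] \<epsilon> by simp
qed

end
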